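(* Let $\alpha_1,\alpha_2\in\mathbb{R}\setminus\{0\}$, $r=\alpha_2/\alpha_1$, $\beta\in\mathbb{R}$, and set $\beta_1=\beta_2=\beta$. Consider the four bilinear estimates (for all $w_1,w_2$): (D1) $\|\partial_x(w_1w_2)\|_{X^{\alpha_2,\beta_2}_{s,b-1}}\le C\|w_1\|_{X^{\alpha_1,\beta_1}_{s,b}}\|w_2\|_{X^{\alpha_1,\beta_1}_{s,b}}$; (D2) $\|\partial_x(w_1w_2)\|_{X^{\alpha_1,\beta_1}_{s,b-1}}\le C\|w_1\|_{X^{\alpha_1,\beta_1}_{s,b}}\|w_2\|_{X^{\alpha_2,\beta_2}_{s,b}}$; (ND1) $\|(\partial_xw_1)w_2\|_{X^{\alpha_1,\beta_1}_{s,b-1}}\le C\|w_1\|_{X^{\alpha_1,\beta_1}_{s,b}}\|w_2\|_{X^{\alpha_2,\beta_2}_{s,b}}$; (ND2) $\|w_1(\partial_xw_2)\|_{X^{\alpha_1,\beta_1}_{s,b-1}}\le C\|w_1\|_{X^{\alpha_1,\beta_1}_{s,b}}\|w_2\|_{X^{\alpha_2,\beta_2}_{s,b}}$. Suppose the type, $r$ and $s$ fall in one of the following cases: for (D1): $r<0$ and $s<-\frac34$; $0<r<\frac14$ and $s<-\frac34$; $r=\frac14$ and $s<\frac34$; $r>\frac14$, $r\ne1$ and $s<0$; $r=1$ and $s<-\frac34$; for (D2): $0<r<\frac14$ and $s<-\frac34$; $r=\frac14$ and $s<\frac34$; $r>\frac14$, $r\ne1$ and $s<0$; $r=1$ and $s<-\frac34$;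 for (ND1) and for (ND2): $r<0$ and $s<-\frac34$; $0<r<\frac14$ and $s<-\frac34$; $r=\frac14$ and $s<\frac34$; $r>\frac14$, $r\neq1$ and $s<0$; $r=1$ and $s<0$. Then for every $b\in\mathbb{R}$ there is no constant $C=C(\alpha_1,\alpha_2,\beta,s,b)$ for which the corresponding estimate holds for all $w_1,w_2$.
   Context: For $\alpha\ne0$, $\beta\in\mathbb{R}$ let $\phi^{\alpha,\beta}(\xi)=\alpha\xi^3-\beta\xi$ and $\langle x\rangle=1+|x|$. For $s,b\in\mathbb{R}$ the Fourier restriction space $X^{\alpha,\beta}_{s,b}$ is the completion of the Schwartz space $\mathscr{S}(\mathbb{R}^2)$ under the norm $\|w\|_{X^{\alpha,\beta}_{s,b}}=\|\langle\xi\rangle^s\langle\tau-\phi^{\alpha,\beta}(\xi)\rangle^b\widehat w(\xi,\tau)\|_{L^2(d\xi\,d\tau)}$, where $\widehat w$ is the space-time Fourier transform. *)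

theory Defs
  imports "HOL-Analysis.Analysis"
begin

definition pdx :: "(real \<times> real \<Rightarrow> complex) \<Rightarrow> (real \<times> real \<Rightarrow> complex)" where
  "pdx f = (\<lambda>(x, t). vector_derivative (\<lambda>y. f (y, t)) (at x))"

definition pdt :: "(real \<times> real \<Rightarrow> complex) \<Rightarrow> (real \<times> real \<Rightarrow> complex)" where
  "pdt f = (\<lambda>(x, t). vector_derivative (\<lambda>y. f (x, y)) (at t))"

definition pder :: "bool list \<Rightarrow> (real \<times> real \<Rightarrow> complex) \<Rightarrow> (real \<times> real \<Rightarrow> complex)" where
  "pder ds f = foldr (\<lambda>d g. if d then pdx g else pdt g) ds f"

definition schwartz :: "(real \<times> real \<Rightarrow> complex) \<Rightarrow> bool" where
  "schwartz f \<longleftrightarrow>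
     (\<forall>ds. continuous_on UNIV (pder ds f)
        \<and> (\<forall>x t. (\<lambda>y. pder ds f (y, t)) differentiable (at x)
                \<and> (\<lambda>y. pder ds f (x, y)) differentiable (at t))
        \<and> (\<forall>j k :: nat. \<exists>B. \<forall>x t. \<bar>x\<bar> ^ j * \<bar>t\<bar> ^ k * cmod (pder ds f (x, t)) \<le> B))"

definition fourier2 :: "(real \<times> real \<Rightarrow> complex) \<Rightarrow> (real \<times> real \<Rightarrow> complex)" where
  "fourier2 w = (\<lambda>(\<xi>, \<tau>). integral\<^sup>L lborel
      (\<lambda>(x, t). cis (- (x * \<xi> + t * \<tau>)) * w (x, t)))"

definition jbr :: "real \<Rightarrow> real" where
  "jbr x = 1 + \<bar>x\<bar>"

definition phi :: "real \<Rightarrow> real \<Rightarrow> real \<Rightarrow> real" where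
  "phi \<alpha> \<beta> \<xi> = \<alpha> * \<xi> ^ 3 - \<beta> * \<xi>"

text \<open>Fourier restriction norm (finite for Schwartz functions).\<close>
definition Xnorm :: "real \<Rightarrow> real \<Rightarrow> real \<Rightarrow> real \<Rightarrow> (real \<times> real \<Rightarrow> complex) \<Rightarrow> real" where
  "Xnorm \<alpha> \<beta> s b w = sqrt (enn2real (\<integral>\<^sup>+ p. ennreal
      ((jbr (fst p) powr s * jbr (snd p - phi \<alpha> \<beta> (fst p)) powr b * cmod (fourier2 w p))\<^sup>2) \<partial>lborel))"

end

(*
  Test the estimates on Gaussian wave packets.  A packet occupies in Fourier space a parallelogram
  of dimensions d x l around a point (xi, tau) with sides along (1, v) and the tau-axis.  The product
  of two packets with the same v, d, l is again such a packet, centred at the sum of the two centres,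
  so no convolution has to be computed and every norm is, up to constants, explicit.  With
  frequencies x1 N, x2 N and N -> infinity a bilinear estimate becomes an inequality between powers
  of N.  It fails on suitable packets:
  - if the resonance function vanishes at (x1, x2): d = N^-2, v = 0 (where the group velocities do
    not matter), or, if the three group velocities agree as for r = 1/4, d = N^(-1/2);
  - if s < -3/4: either two opposite packets with d = 1, l = N for (D1), which works for all b >= 0
    at once, or the conflict of two examples, one with a modulation of size N^3 on an input (this
    forces s + 3 max(b,0) >= 3/4) and one with it on the output.
*)

theory Submission
  imports Defs "HOL-Probability.Probability"
begin

section \<open>Gaussian integrals\<close>

text \<open>Why these scales. The transform of a packet has height about 1/(d l) on a set of area d
  l, so its norm is its weight divided by sqrt(d l). Both factors and the product carry such a
  denominator, hence an estimate forces (output weight) * sqrt(d l) <= C * (product of input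
  weights), and at equal weights large packets are the stronger test. The width is limited by the
  Taylor expansion of \<phi> at frequencies of size N. Slopes in general differ by about N^2, so
  only d = N^-2 keeps the modulation bounded; with a common slope v only the curvature, about N, is
  left and d = N^(-1/2) suffices. At r = 1/4 the resonance function has a double zero, which is
  where the slopes agree; hence the jump of the threshold to 3/4. As \<beta> is the same for all
  three symbols, the term -\<beta>\<xi> drops out of resonances and of slope differences. Total
  frequency zero is a good test when the derivative falls on one factor, where it keeps size N, but
  a derivative of the product nearly annihilates it; this separates (ND1), (ND2) from (D1),
  (D2).\<close>

lemma std_normal_density_scaleR:
  "std_normal_density y *\<^sub>R (complex_of_real (sqrt (2 * pi)) * z) = of_real (exp (- y\<^sup>2 / 2)) * z"
proof -
  have "std_normal_density y * sqrt (2 * pi) = exp (- y\<^sup>2 / 2)"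
    by (simp add: std_normal_density_def)
  thus ?thesis
    by (simp only: scaleR_conv_of_real flip: of_real_mult mult.assoc)
qed

lemma integrable_gaussian_moment:
  "integrable lborel (\<lambda>y. cis (- (y * \<eta>)) * (of_real (y ^ k) * of_real (exp (- y\<^sup>2 / 2))) :: complex)"
proof (rule Bochner_Integration.integrable_bound)
  show "integrable lborel (\<lambda>y. sqrt (2 * pi) * (std_normal_density y * \<bar>y\<bar> ^ k))"
    by (intro integrable_mult_right integrable_std_normal_moment_abs)
  show "(\<lambda>y. cis (- (y * \<eta>)) * (of_real (y ^ k) * of_real (exp (- y\<^sup>2 / 2))) :: complex) \<in> borel_measurable lborel"
    unfolding cis_conv_exp by measurable
qed (auto simp: norm_mult norm_power std_normal_density_def)

text \<open>This is the characteristic function of the standard normal distribution at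
  \<open>- \<eta>\<close>, freed of its normalisation.\<close>

lemma integral_gaussian_cis:
  "(LINT y|lborel. cis (- (y * \<eta>)) * of_real (exp (- y\<^sup>2 / 2)))
     = complex_of_real (sqrt (2 * pi) * exp (- \<eta>\<^sup>2 / 2))"
proof -
  have "complex_of_real (exp (- (- \<eta>)\<^sup>2 / 2)) = char std_normal_distribution (- \<eta>)"
    by (simp add: char_std_normal_distribution)
  also have "\<dots> = (LINT y|lborel. std_normal_density y *\<^sub>R cis (- (y * \<eta>)))"
    unfolding char_def
    by (subst integral_density) (auto simp: cis_conv_exp mult_ac intro!: Bochner_Integration.integral_cong)
  finally have "complex_of_real (sqrt (2 * pi) * exp (- \<eta>\<^sup>2 / 2))
      = of_real (sqrt (2 * pi)) * (LINT y|lborel. std_normal_density y *\<^sub>R cis (- (y * \<eta>)))"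
    by simp
  also have "\<dots> = (LINT y|lborel. of_real (sqrt (2 * pi)) * (std_normal_density y *\<^sub>R cis (- (y * \<eta>))))"
    by (rule integral_mult_right_zero[symmetric])
  also have "\<dots> = (LINT y|lborel. cis (- (y * \<eta>)) * of_real (exp (- y\<^sup>2 / 2)))"
    using std_normal_density_scaleR
    by (intro Bochner_Integration.integral_cong) (auto simp: mult_ac)
  finally show ?thesis ..
qed

lemma cis_gaussian_has_vector_derivative:
  "((\<lambda>y. cis (- (y * \<eta>)) * of_real (exp (- y\<^sup>2 / 2))) has_vector_derivative
     - (\<i> * of_real \<eta>) * (cis (- (y * \<eta>)) * of_real (exp (- y\<^sup>2 / 2)))
     - cis (- (y * \<eta>)) * (of_real y * of_real (exp (- y\<^sup>2 / 2)))) (at y)"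
proof -
  \<comment> \<open>The function extends to an entire one, so the rules for complex derivatives
    apply before restricting to the real line.\<close>
  have *: "((\<lambda>z. exp (- (\<i> * z * of_real \<eta>)) * exp (- z\<^sup>2 / 2)) has_field_derivative
     - (\<i> * of_real \<eta>) * (exp (- (\<i> * z * of_real \<eta>)) * exp (- z\<^sup>2 / 2))
     - exp (- (\<i> * z * of_real \<eta>)) * (z * exp (- z\<^sup>2 / 2))) (at z)" for z :: complex
    by (auto intro!: derivative_eq_intros simp: algebra_simps)
  have eq: "(\<lambda>z. exp (- (\<i> * z * of_real \<eta>)) * exp (- z\<^sup>2 / 2)) \<circ> complex_of_real
    = (\<lambda>y. cis (- (y * \<eta>)) * of_real (exp (- y\<^sup>2 / 2)))"
    by (auto simp: fun_eq_iff cis_conv_exp exp_of_real[symmetric] mult_ac)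
  show ?thesis
    using has_vector_derivative_real_field[OF *, of y] unfolding eq[unfolded comp_def]
    by (simp add: eq[unfolded comp_def fun_eq_iff] cis_conv_exp exp_of_real[symmetric] mult_ac)
qed

text \<open>The derivative of the oscillating Gaussian integrates to 0 because the Gaussian vanishes
  at both ends; this expresses the first moment by the integral without the factor y. It serves the
  linear factor that an x-derivative leaves behind.\<close>

lemma integral_gaussian_cis_moment:
  "(LINT y|lborel. cis (- (y * \<eta>)) * (of_real y * of_real (exp (- y\<^sup>2 / 2))))
     = - \<i> * of_real \<eta> * complex_of_real (sqrt (2 * pi) * exp (- \<eta>\<^sup>2 / 2))"
proof -
  define F where "F y = cis (- (y * \<eta>)) * of_real (exp (- y\<^sup>2 / 2))" for y
  define f where "f y = - (\<i> * of_real \<eta>) * F y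
    - cis (- (y * \<eta>)) * (of_real y * of_real (exp (- y\<^sup>2 / 2)))" for y
  have int0: "integrable lborel F" 
    using integrable_gaussian_moment[of \<eta> 0] by (simp add: F_def[abs_def])
  have int1: "integrable lborel (\<lambda>y. cis (- (y * \<eta>)) * (of_real y * of_real (exp (- y\<^sup>2 / 2))))" 
    using integrable_gaussian_moment[of \<eta> 1] by simp
  have intf: "integrable lborel f"
    unfolding f_def by (intro Bochner_Integration.integrable_diff integrable_mult_right int0 int1)
  have lim: "((\<lambda>y::real. exp (- y\<^sup>2 / 2)) \<longlongrightarrow> 0) at_top" "((\<lambda>y::real. exp (- y\<^sup>2 / 2)) \<longlongrightarrow> 0) at_bot"
    by real_asymp+
  have normF: "norm (F y) = exp (- y\<^sup>2 / 2)" for y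
    by (simp add: F_def norm_mult)
  have limF: "(F \<longlongrightarrow> 0) at_top" "(F \<longlongrightarrow> 0) at_bot"
    using lim by (auto intro!: tendsto_norm_zero_cancel[of F] simp: normF)
  have "(LBINT y=-\<infinity>..\<infinity>. f y) = 0 - 0"
  proof (rule interval_integral_FTC_integrable[where F = F])
    show "(F has_vector_derivative f y) (at y)" for y
      using cis_gaussian_has_vector_derivative unfolding F_def f_def .
    show "isCont f y" for y
      unfolding f_def F_def cis_conv_exp by (auto intro!: continuous_intros)
    show "set_integrable lborel (einterval (-\<infinity>) \<infinity>) f"
      using intf by (simp add: set_integrable_def einterval_def)
    show "((F \<circ> real_of_ereal) \<longlongrightarrow> 0) (at_right (-\<infinity>))" "((F \<circ> real_of_ereal) \<longlongrightarrow> 0) (at_left \<infinity>)"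
      using limF by (simp_all add: ereal_tendsto_simps)
  qed auto
  hence "(LINT y|lborel. f y) = 0"
    by (simp add: interval_lebesgue_integral_def set_lebesgue_integral_def einterval_def)
  hence "(LINT y|lborel. cis (- (y * \<eta>)) * (of_real y * of_real (exp (- y\<^sup>2 / 2)))) 
    = - (\<i> * of_real \<eta>) * (LINT y|lborel. F y)"
    unfolding f_def using int0 int1 by simp
  thus ?thesis
    unfolding F_def integral_gaussian_cis by simp
qed

section \<open>Wave packets\<close>

text \<open>The linear factor multiplies the Fourier transform by \<open>a + \<i> c (\<xi>' - \<xi>)\<close>, where \<open>\<xi>'\<close> is the
  dual variable of \<open>x\<close>; this makes room for the \<open>x\<close>-derivatives.\<close>

definition wave_packet ::
  "complex \<Rightarrow> real \<Rightarrow> real \<Rightarrow> real \<Rightarrow> real \<Rightarrow> real \<Rightarrow> real \<Rightarrow> real \<times> real \<Rightarrow> complex" where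
  "wave_packet a c \<xi> \<tau> v d l = (\<lambda>(x, t). (a - of_real (c * d\<^sup>2 * (x + v * t)))
     * exp (\<i> * of_real (x * \<xi> + t * \<tau>) - of_real (((d * (x + v * t))\<^sup>2 + (l * t)\<^sup>2) / 2)))"

text \<open>In the coordinates y = d(x + vt) and lt the phase x\<xi>' + t\<tau>' minus its value at
  the centre becomes \<eta> y + u(lt), so the transform splits into two one-dimensional ones. The
  shear of (x, t) is dual to the slope v of the parallelogram.\<close>

lemma fourier2_wave_packet:
  assumes d: "0 < d" and l: "0 < l"
  shows "fourier2 (wave_packet a c \<xi> \<tau> v d l) (\<xi> + d * \<eta>, \<tau> + v * (d * \<eta>) + l * u)
    = of_real (2 * pi / (d * l)) * (a + \<i> * of_real (c * d * \<eta>)) * of_real (exp (- (\<eta>\<^sup>2 + u\<^sup>2) / 2))"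
proof -
  define E where "E \<theta> y = cis (- (y * \<theta>)) * complex_of_real (exp (- y\<^sup>2 / 2))" for \<theta> y :: real
  \<comment> \<open>\<open>H\<close> is the one-dimensional integrand including the linear factor,
    since c d^2 (x + vt) = c d y.\<close>
  define H where "H y = a * E \<eta> y - of_real (c * d) * (cis (- (y * \<eta>)) * (of_real y * of_real (exp (- y\<^sup>2 / 2))))" for y
  \<comment> \<open>With t first, the inner integral runs over x, in which the argument of
    \<open>H\<close> is affine. The summand 0 matches the shape of the affine substitution
    rule.\<close>
  define f where "f = (\<lambda>(t, x). H (d * v * t + d * x) * E u (0 + l * t))"
  have intE: "integrable lborel (E \<theta>)" for \<theta>
    using integrable_gaussian_moment[of \<theta> 0] by (simp add: E_def[abs_def])
  have intM: "integrable lborel (\<lambda>y. cis (- (y * \<eta>)) * (complex_of_real y * of_real (exp (- y\<^sup>2 / 2))))"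
    using integrable_gaussian_moment[of \<eta> 1] by simp
  have intH: "integrable lborel H"
    unfolding H_def by (intro Bochner_Integration.integrable_diff integrable_mult_right intE intM)
  have valH: "(LINT y|lborel. H y) = (a + \<i> * of_real (c * d * \<eta>)) * of_real (sqrt (2 * pi) * exp (- \<eta>\<^sup>2 / 2))"
  proof -
    have "(LINT y|lborel. H y) = a * (LINT y|lborel. E \<eta> y)
        - of_real (c * d) * (LINT y|lborel. cis (- (y * \<eta>)) * (of_real y * of_real (exp (- y\<^sup>2 / 2))))"
      unfolding H_def using intE[of \<eta>] intM
      by (subst Bochner_Integration.integral_diff) (simp_all only: integrable_mult_right integral_mult_right_zero)
    thus ?thesis
      by (simp only: integral_gaussian_cis_moment integral_gaussian_cis[of \<eta>, folded E_def])
         (simp add: algebra_simps)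
  qed
  have inner: "(LINT x|lborel. f (t, x)) = of_real (1 / d) * (LINT y|lborel. H y) * E u (0 + l * t)" for t
    using d lborel_integral_real_affine[of d H "d * v * t"]
    by (simp add: f_def scaleR_conv_of_real)
  have inner_norm: "(LINT x|lborel. norm (f (t, x))) = 1 / d * (LINT y|lborel. norm (H y)) * norm (E u (0 + l * t))" for t
    using d lborel_integral_real_affine[of d "\<lambda>y. norm (H y)" "d * v * t"]
    by (simp add: f_def norm_mult)
  have sqrt_sq: "complex_of_real (sqrt (2 * pi)) * complex_of_real (sqrt (2 * pi)) = 2 * complex_of_real pi"
    by (simp only: of_real_mult[symmetric] real_sqrt_mult_self) simp
  have measE: "E \<theta> \<in> borel_measurable borel" for \<theta>
    using intE borel_measurable_integrable by force
  have measH: "H \<in> borel_measurable borel"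
    using intH borel_measurable_integrable by force
  have intf: "integrable (lborel \<Otimes>\<^sub>M lborel) f"
  proof (rule lborel_pair.Fubini_integrable)
    show "f \<in> borel_measurable (lborel \<Otimes>\<^sub>M lborel)"
      unfolding f_def using measE measH by measurable
    show "integrable lborel (\<lambda>t. LINT x|lborel. norm (f (t, x)))"
      unfolding inner_norm using l
      by (intro integrable_mult_right integrable_norm lborel_integrable_real_affine intE) auto
    show "AE t in lborel. integrable lborel (\<lambda>x. f (t, x))"
      unfolding f_def using d
      by (auto intro!: AE_I2 lborel_integrable_real_affine intH)
  qed
  have eq: "cis (- (x * (\<xi> + d * \<eta>) + t * (\<tau> + v * (d * \<eta>) + l * u))) * wave_packet a c \<xi> \<tau> v d l (x, t) = f (t, x)" for x t
  proof -
    define y where "y = d * (x + v * t)"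
    have y: "d * v * t + d * x = y" by (simp add: y_def algebra_simps)
    have 1: "cis (- (x * (\<xi> + d * \<eta>) + t * (\<tau> + v * (d * \<eta>) + l * u))) *
        exp (\<i> * of_real (x * \<xi> + t * \<tau>) - of_real (((d * (x + v * t))\<^sup>2 + (l * t)\<^sup>2) / 2))
       = E \<eta> y * E u (l * t)"
      unfolding E_def cis_conv_exp exp_of_real[symmetric] exp_add[symmetric] y_def
      by (rule arg_cong[where f = exp]) (simp add: field_simps)
    have 2: "H y = (a - of_real (c * d * y)) * E \<eta> y"
      by (simp add: H_def E_def algebra_simps)
    have 3: "c * d\<^sup>2 * (x + v * t) = c * d * y"
      by (simp add: y_def power2_eq_square)
    show ?thesis
      unfolding wave_packet_def f_def prod.case y 3 2 add_0_left
      by (subst mult.left_commute) (simp only: 1 mult.assoc)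
  qed
  have "fourier2 (wave_packet a c \<xi> \<tau> v d l) (\<xi> + d * \<eta>, \<tau> + v * (d * \<eta>) + l * u)
     = (LINT (x, t)|(lborel \<Otimes>\<^sub>M lborel). f (t, x))"
    unfolding fourier2_def prod.case lborel_prod
  proof (rule Bochner_Integration.integral_cong[OF refl])
    fix p :: "real \<times> real"
    show "(case p of (x, t) \<Rightarrow> cis (- (x * (\<xi> + d * \<eta>) + t * (\<tau> + v * (d * \<eta>) + l * u))) * wave_packet a c \<xi> \<tau> v d l (x, t))
        = (case p of (x, t) \<Rightarrow> f (t, x))"
      by (cases p) (simp only: prod.case eq)
  qed
  also have "\<dots> = (LINT p|(lborel \<Otimes>\<^sub>M lborel). f p)"
    using lborel_pair.integral_product_swap[of f] measE measH intf by simp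
  also have "\<dots> = (LINT t|lborel. LINT x|lborel. f (t, x))"
    by (rule lborel_pair.integral_fst'[OF intf, symmetric])
  also have "\<dots> = of_real (1 / d) * (LINT y|lborel. H y) * (LINT t|lborel. E u (0 + l * t))"
    unfolding inner by (rule integral_mult_right_zero)
  also have "(LINT t|lborel. E u (0 + l * t)) = of_real (1 / l) * of_real (sqrt (2 * pi) * exp (- u\<^sup>2 / 2))"
    using l lborel_integral_real_affine[of l "E u" 0] integral_gaussian_cis[of u, folded E_def]
    by (simp add: scaleR_conv_of_real)
  also have "of_real (1 / d) * (LINT y|lborel. H y) * (of_real (1 / l) * of_real (sqrt (2 * pi) * exp (- u\<^sup>2 / 2)))
    = complex_of_real (sqrt (2 * pi) * sqrt (2 * pi) / (d * l)) * (a + \<i> * of_real (c * d * \<eta>)) * of_real (exp (- \<eta>\<^sup>2 / 2) * exp (- u\<^sup>2 / 2))"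
    unfolding valH by (simp add: sqrt_sq)
  also have "\<dots> = of_real (2 * pi / (d * l)) * (a + \<i> * of_real (c * d * \<eta>)) * of_real (exp (- (\<eta>\<^sup>2 + u\<^sup>2) / 2))"
    by (simp only: real_sqrt_mult_self abs_mult exp_add[symmetric]) (simp add: add_divide_distrib)
  finally show ?thesis .
qed

text \<open>The logarithmic x-derivative is \<i>\<xi> - d^2 (x + vt), which is the linear factor
  with a = \<i>\<xi> and c = 1.\<close>

lemma pdx_wave_packet:
  "pdx (wave_packet 1 0 \<xi> \<tau> v d l) = wave_packet (\<i> * of_real \<xi>) 1 \<xi> \<tau> v d l"
proof -
  have "((\<lambda>y. exp (\<i> * of_real (y * \<xi> + t * \<tau>) - of_real (((d * (y + v * t))\<^sup>2 + (l * t)\<^sup>2) / 2)))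
     has_vector_derivative wave_packet (\<i> * of_real \<xi>) 1 \<xi> \<tau> v d l (x, t)) (at x)" for x t
  proof -
    have "((\<lambda>w. exp (\<i> * (w * of_real \<xi> + of_real (t * \<tau>)) -
          ((of_real d * (w + of_real (v * t)))\<^sup>2 + of_real ((l * t)\<^sup>2)) / 2))
     has_field_derivative wave_packet (\<i> * of_real \<xi>) 1 \<xi> \<tau> v d l (x, t)) (at (of_real x))"
      by (auto intro!: derivative_eq_intros simp: wave_packet_def algebra_simps power2_eq_square)
    from has_vector_derivative_real_field[OF this] show ?thesis
      by simp
  qed
  thus ?thesis
    by (auto simp: pdx_def fun_eq_iff wave_packet_def intro!: vector_derivative_at)
qed

text \<open>Adding two equal quadratic exponents doubles them, which scales d and l by sqrt 2. The
  linear factor depends on c d^2 only, so c is halved.\<close>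

lemma wave_packet_mult:
  "wave_packet a c \<xi> \<tau> v d l z * wave_packet 1 0 \<xi>' \<tau>' v d l z
    = wave_packet a (c / 2) (\<xi> + \<xi>') (\<tau> + \<tau>') v (sqrt 2 * d) (sqrt 2 * l) z"
proof -
  obtain x t where z: "z = (x, t)" by fastforce
  define P R where "P = (d * (x + v * t))\<^sup>2" and "R = (l * t)\<^sup>2"
  have PR: "(sqrt 2 * d * (x + v * t))\<^sup>2 = 2 * P" "(sqrt 2 * l * t)\<^sup>2 = 2 * R"
    "c / 2 * (sqrt 2 * d)\<^sup>2 * (x + v * t) = c * d\<^sup>2 * (x + v * t)"
    by (simp_all add: P_def R_def power_mult_distrib)
  have e: "exp (\<i> * of_real (x * \<xi> + t * \<tau>) - of_real ((P + R) / 2))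
      * exp (\<i> * of_real (x * \<xi>' + t * \<tau>') - of_real ((P + R) / 2))
    = exp (\<i> * of_real (x * (\<xi> + \<xi>') + t * (\<tau> + \<tau>')) - of_real ((2 * P + 2 * R) / 2))"
    unfolding exp_add[symmetric]
    by (rule arg_cong[where f = exp]) (simp add: algebra_simps)
  show ?thesis
    unfolding z wave_packet_def prod.case PR P_def[symmetric] R_def[symmetric] e[symmetric]
    by simp
qed

section \<open>The Schwartz property: polynomials times exponentials of polynomials\<close>

inductive poly2 :: "(real \<times> real \<Rightarrow> complex) \<Rightarrow> bool" where
  const: "poly2 (\<lambda>_. c)"
| fst: "poly2 (\<lambda>z. of_real (fst z))"
| snd: "poly2 (\<lambda>z. of_real (snd z))"
| add: "poly2 p \<Longrightarrow> poly2 q \<Longrightarrow> poly2 (\<lambda>z. p z + q z)"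
| mult: "poly2 p \<Longrightarrow> poly2 q \<Longrightarrow> poly2 (\<lambda>z. p z * q z)"

lemma poly2_diff: "poly2 p \<Longrightarrow> poly2 q \<Longrightarrow> poly2 (\<lambda>z. p z - q z)"
  using poly2.add[of p "\<lambda>z. (- 1) * q z"] poly2.mult[OF poly2.const[of "-1"], of q] by simp

lemma continuous_on_poly2: "poly2 p \<Longrightarrow> continuous_on UNIV p"
  by (induction rule: poly2.induct) (auto intro!: continuous_intros)

lemma poly2_dx:
  assumes "poly2 p"
  shows "\<exists>p'. poly2 p' \<and> (\<forall>x t. ((\<lambda>y. p (y, t)) has_vector_derivative p' (x, t)) (at x))"
  using assms
proof induction
  case (add p q)
  then obtain p' q' where "poly2 p'" "poly2 q'"
    "\<And>x t. ((\<lambda>y. p (y, t)) has_vector_derivative p' (x, t)) (at x)"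
    "\<And>x t. ((\<lambda>y. q (y, t)) has_vector_derivative q' (x, t)) (at x)" by auto
  thus ?case
    by (intro exI[of _ "\<lambda>z. p' z + q' z"]) (auto intro!: poly2.intros derivative_intros)
next
  case (mult p q)
  then obtain p' q' where "poly2 p'" "poly2 q'"
    "\<And>x t. ((\<lambda>y. p (y, t)) has_vector_derivative p' (x, t)) (at x)"
    "\<And>x t. ((\<lambda>y. q (y, t)) has_vector_derivative q' (x, t)) (at x)" by auto
  with mult.hyps show ?case
    by (intro exI[of _ "\<lambda>z. p z * q' z + p' z * q z"])
       (auto intro!: poly2.intros has_vector_derivative_mult)
next
  case (const c)
  show ?case by (intro exI[of _ "\<lambda>_. 0"]) (auto intro: poly2.const)
next
  case fst
  show ?case by (intro exI[of _ "\<lambda>_. 1"]) (auto intro: poly2.const has_vector_derivative_real_field[OF DERIV_ident])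
next
  case snd
  show ?case by (intro exI[of _ "\<lambda>_. 0"]) (auto intro: poly2.const)
qed

lemma poly2_swap: "poly2 p \<Longrightarrow> poly2 (p \<circ> prod.swap)"
  by (induction rule: poly2.induct) (auto simp: comp_def intro: poly2.intros)

lemma poly2_growth:
  assumes "poly2 p"
  shows "\<exists>B n. \<forall>x t. cmod (p (x, t)) \<le> B * ((1 + \<bar>x\<bar>) * (1 + \<bar>t\<bar>)) ^ n"
  using assms
proof induction
  case (const c)
  show ?case by (intro exI[of _ "cmod c"] exI[of _ 0]) auto
next
  case fst
  show ?case by (intro exI[of _ 1]) (auto simp: algebra_simps)
next
  case snd
  show ?case by (intro exI[of _ 1]) (auto simp: algebra_simps)
next
  case (add p q)
  then obtain B n B' n' where *:
    "\<And>x t. cmod (p (x, t)) \<le> B * ((1 + \<bar>x\<bar>) * (1 + \<bar>t\<bar>)) ^ n"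
    "\<And>x t. cmod (q (x, t)) \<le> B' * ((1 + \<bar>x\<bar>) * (1 + \<bar>t\<bar>)) ^ n'" by auto
  have "cmod (p (x, t) + q (x, t)) \<le> (\<bar>B\<bar> + \<bar>B'\<bar>) * ((1 + \<bar>x\<bar>) * (1 + \<bar>t\<bar>)) ^ (max n n')" for x t
  proof -
    define X where "X = (1 + \<bar>x\<bar>) * (1 + \<bar>t\<bar>)"
    have X: "1 \<le> X" unfolding X_def by (simp add: algebra_simps)
    have "B * X ^ n \<le> \<bar>B\<bar> * X ^ max n n'" "B' * X ^ n' \<le> \<bar>B'\<bar> * X ^ max n n'"
      using X by (auto intro!: mult_mono power_increasing)
    thus ?thesis
      using norm_triangle_ineq[of "p (x, t)" "q (x, t)"] *[of x t]
      unfolding X_def[symmetric] by (simp add: algebra_simps)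
  qed
  thus ?case by blast
next
  case (mult p q)
  then obtain B n B' n' where *:
    "\<And>x t. cmod (p (x, t)) \<le> B * ((1 + \<bar>x\<bar>) * (1 + \<bar>t\<bar>)) ^ n"
    "\<And>x t. cmod (q (x, t)) \<le> B' * ((1 + \<bar>x\<bar>) * (1 + \<bar>t\<bar>)) ^ n'" by auto
  have "cmod (p (x, t) * q (x, t)) \<le> (B * B') * ((1 + \<bar>x\<bar>) * (1 + \<bar>t\<bar>)) ^ (n + n')" for x t
    using mult_mono[OF *[of x t] order_trans[OF norm_ge_zero *(1)] norm_ge_zero]
    by (simp add: norm_mult power_add mult_ac)
  thus ?case by blast
qed

text \<open>A class closed under both partial derivatives, so that iterated derivatives need no
  formula: differentiation changes only \<open>p\<close>. The decay condition involves only
  \<open>Q\<close> and is therefore inherited; it beats every power, hence also the growth of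
  \<open>p\<close>.\<close>

definition gaussian_poly :: "(real \<times> real \<Rightarrow> complex) \<Rightarrow> bool" where
  "gaussian_poly f \<longleftrightarrow> (\<exists>p Q. poly2 p \<and> poly2 Q \<and> f = (\<lambda>z. p z * exp (Q z)) \<and>
     (\<forall>n. \<exists>B. \<forall>x t. ((1 + \<bar>x\<bar>) * (1 + \<bar>t\<bar>)) ^ n * exp (Re (Q (x, t))) \<le> B))"

lemma gaussian_poly_swap: "gaussian_poly f \<Longrightarrow> gaussian_poly (f \<circ> prod.swap)"
proof -
  assume "gaussian_poly f"
  then obtain p Q where *: "poly2 p" "poly2 Q" "f = (\<lambda>z. p z * exp (Q z))"
    "\<And>n. \<exists>B. \<forall>x t. ((1 + \<bar>x\<bar>) * (1 + \<bar>t\<bar>)) ^ n * exp (Re (Q (x, t))) \<le> B"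
    unfolding gaussian_poly_def by blast
  have "\<exists>B. \<forall>x t. ((1 + \<bar>x\<bar>) * (1 + \<bar>t\<bar>)) ^ n * exp (Re (Q (t, x))) \<le> B" for n
    using *(4)[of n] by (metis mult.commute)
  with *(1-3) show ?thesis
    unfolding gaussian_poly_def
    by (intro exI[of _ "p \<circ> prod.swap"] exI[of _ "Q \<circ> prod.swap"])
       (auto intro: poly2_swap)
qed

lemma gaussian_poly_dx:
  assumes "gaussian_poly f"
  shows "gaussian_poly (pdx f)" "((\<lambda>y. f (y, t)) has_vector_derivative pdx f (x, t)) (at x)"
proof -
  obtain p Q where *: "poly2 p" "poly2 Q" "f = (\<lambda>z. p z * exp (Q z))"
    "\<And>n. \<exists>B. \<forall>x t. ((1 + \<bar>x\<bar>) * (1 + \<bar>t\<bar>)) ^ n * exp (Re (Q (x, t))) \<le> B"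
    using assms unfolding gaussian_poly_def by blast
  obtain p' Q' where d: "poly2 p'" "poly2 Q'"
    "\<And>x t. ((\<lambda>y. p (y, t)) has_vector_derivative p' (x, t)) (at x)"
    "\<And>x t. ((\<lambda>y. Q (y, t)) has_vector_derivative Q' (x, t)) (at x)"
    using poly2_dx[OF *(1)] poly2_dx[OF *(2)] by blast
  have deriv: "((\<lambda>y. f (y, t)) has_vector_derivative
      (p (x, t) * Q' (x, t) + p' (x, t)) * exp (Q (x, t))) (at x)" for x t
  proof -
    have "((exp \<circ> (\<lambda>y. Q (y, t))) has_vector_derivative Q' (x, t) * exp (Q (x, t))) (at x)"
      by (intro field_vector_diff_chain_at d(4) DERIV_exp)
    from has_vector_derivative_mult[OF d(3) this] show ?thesis
      by (simp add: *(3) comp_def algebra_simps)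
  qed
  have eq: "pdx f = (\<lambda>z. (p z * Q' z + p' z) * exp (Q z))"
    using deriv by (auto simp: pdx_def fun_eq_iff intro!: vector_derivative_at)
  show "gaussian_poly (pdx f)"
    unfolding gaussian_poly_def
    by (rule exI[of _ "\<lambda>z. p z * Q' z + p' z"], rule exI[of _ Q])
       (use *(1,2,4) d in \<open>auto simp: eq intro!: poly2.add poly2.mult\<close>)
  show "((\<lambda>y. f (y, t)) has_vector_derivative pdx f (x, t)) (at x)"
    using deriv by (simp add: eq)
qed

text \<open>Exchanging the coordinates reduces every statement on t-derivatives to the one on
  x-derivatives.\<close>

lemma pdt_conv_pdx: "pdt f = pdx (f \<circ> prod.swap) \<circ> prod.swap"
  by (auto simp: pdt_def pdx_def)

lemma gaussian_poly_dt:
  assumes "gaussian_poly f"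
  shows "gaussian_poly (pdt f)" "((\<lambda>y. f (x, y)) has_vector_derivative pdt f (x, t)) (at t)"
  using gaussian_poly_swap[OF gaussian_poly_dx(1)[OF gaussian_poly_swap[OF assms]]]
    gaussian_poly_dx(2)[OF gaussian_poly_swap[OF assms], of x t]
  by (simp_all add: pdt_conv_pdx)

lemma gaussian_poly_pder: "gaussian_poly f \<Longrightarrow> gaussian_poly (pder ds f)"
  by (induction ds) (auto simp: pder_def gaussian_poly_dx gaussian_poly_dt)

lemma gaussian_poly_bound:
  assumes "gaussian_poly f"
  shows "\<exists>B. \<forall>x t. \<bar>x\<bar> ^ j * \<bar>t\<bar> ^ k * cmod (f (x, t)) \<le> B"
proof -
  obtain p Q where *: "poly2 p" "poly2 Q" "f = (\<lambda>z. p z * exp (Q z))"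
    "\<And>n. \<exists>B. \<forall>x t. ((1 + \<bar>x\<bar>) * (1 + \<bar>t\<bar>)) ^ n * exp (Re (Q (x, t))) \<le> B"
    using assms unfolding gaussian_poly_def by blast
  obtain B n where B: "\<And>x t. cmod (p (x, t)) \<le> B * ((1 + \<bar>x\<bar>) * (1 + \<bar>t\<bar>)) ^ n"
    using poly2_growth[OF *(1)] by blast
  obtain B' where B': "\<And>x t. ((1 + \<bar>x\<bar>) * (1 + \<bar>t\<bar>)) ^ (j + k + n) * exp (Re (Q (x, t))) \<le> B'"
    using *(4) by blast
  have "\<bar>x\<bar> ^ j * \<bar>t\<bar> ^ k * cmod (f (x, t)) \<le> \<bar>B\<bar> * B'" for x t
  proof -
    define X where "X = (1 + \<bar>x\<bar>) * (1 + \<bar>t\<bar>)"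
    have X: "\<bar>x\<bar> \<le> X" "\<bar>t\<bar> \<le> X" "0 \<le> X" unfolding X_def by (auto simp: algebra_simps)
    have "cmod (p (x, t)) \<le> \<bar>B\<bar> * X ^ n"
      using B[of x t] X by (smt (verit) X_def mult_right_mono zero_le_power)
    hence "\<bar>x\<bar> ^ j * \<bar>t\<bar> ^ k * (cmod (p (x, t)) * exp (Re (Q (x, t))))
      \<le> X ^ j * X ^ k * ((\<bar>B\<bar> * X ^ n) * exp (Re (Q (x, t))))"
      using X by (intro mult_mono power_mono) auto
    also have "\<dots> = \<bar>B\<bar> * (X ^ (j + k + n) * exp (Re (Q (x, t))))"
      by (simp add: power_add)
    also have "\<dots> \<le> \<bar>B\<bar> * B'"
      using B'[of x t] unfolding X_def[symmetric] by (intro mult_left_mono) auto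
    finally show ?thesis by (simp add: *(3) norm_mult)
  qed
  thus ?thesis by blast
qed

lemma schwartz_gaussian_poly:
  assumes "gaussian_poly f"
  shows "schwartz f"
  unfolding schwartz_def
proof (intro allI conjI)
  fix ds
  have f: "gaussian_poly (pder ds f)" using assms by (rule gaussian_poly_pder)
  then obtain p Q where *: "poly2 p" "poly2 Q" "pder ds f = (\<lambda>z. p z * exp (Q z))"
    unfolding gaussian_poly_def by blast
  show "continuous_on UNIV (pder ds f)"
    unfolding *(3) by (intro continuous_on_mult continuous_on_exp continuous_on_poly2[OF *(1)] continuous_on_poly2[OF *(2)])
  fix x t
  show "(\<lambda>y. pder ds f (y, t)) differentiable (at x)" "(\<lambda>y. pder ds f (x, y)) differentiable (at t)"
    using gaussian_poly_dx(2)[OF f] gaussian_poly_dt(2)[OF f] by (blast intro: differentiableI_vector)+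
  fix j k
  show "\<exists>B. \<forall>x t. \<bar>x\<bar> ^ j * \<bar>t\<bar> ^ k * cmod (pder ds f (x, t)) \<le> B"
    using f by (rule gaussian_poly_bound)
qed

lemma power_times_gaussian_le: "(1 + \<bar>y\<bar>) ^ n * exp (- y\<^sup>2 / 2) \<le> exp ((real n)\<^sup>2 / 2)" for y :: real
proof -
  have "(1 + \<bar>y\<bar>) ^ n \<le> exp \<bar>y\<bar> ^ n"
    using exp_ge_add_one_self[of "\<bar>y\<bar>"] by (intro power_mono) auto
  also have "\<dots> = exp (real n * \<bar>y\<bar>)" by (simp add: exp_of_nat_mult)
  finally have "(1 + \<bar>y\<bar>) ^ n * exp (- y\<^sup>2 / 2) \<le> exp (real n * \<bar>y\<bar>) * exp (- y\<^sup>2 / 2)"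
    by (intro mult_right_mono) auto
  also have "\<dots> \<le> exp ((real n)\<^sup>2 / 2)"
  proof -
    have "0 \<le> (real n - \<bar>y\<bar>)\<^sup>2" by simp
    thus ?thesis unfolding exp_add[symmetric] by (simp add: power2_diff)
  qed
  finally show ?thesis .
qed

lemma schwartz_wave_packet:
  assumes d: "0 < d" and l: "0 < l"
  shows "schwartz (wave_packet a c \<xi> \<tau> v d l)"
proof (rule schwartz_gaussian_poly)
  let ?x = "\<lambda>z. complex_of_real (fst z)" and ?t = "\<lambda>z. complex_of_real (snd z)"
  define X where "X z = ?x z + of_real v * ?t z" for z
  define p where "p z = a - of_real (c * d\<^sup>2) * X z" for z
  define Q where "Q z = (\<i> * of_real \<xi> * ?x z + \<i> * of_real \<tau> * ?t z)
      - (of_real (d\<^sup>2 / 2) * (X z * X z) + of_real (l\<^sup>2 / 2) * (?t z * ?t z))" for z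
  have X: "poly2 X" unfolding X_def by (intro poly2.intros)
  have "poly2 p" "poly2 Q"
    unfolding p_def Q_def by (intro poly2.intros poly2_diff X)+
  moreover have "wave_packet a c \<xi> \<tau> v d l = (\<lambda>z. p z * exp (Q z))"
    by (auto simp: wave_packet_def p_def Q_def X_def fun_eq_iff power2_eq_square algebra_simps add_divide_distrib)
  moreover have "\<exists>B. \<forall>x t. ((1 + \<bar>x\<bar>) * (1 + \<bar>t\<bar>)) ^ n * exp (Re (Q (x, t))) \<le> B" for n
  proof -
    \<comment> \<open>Inverting y = d(x + vt), u = lt gives x = y/d - vu/l and t = u/l. The first
      factor of \<open>M\<close> comes from x, the second from t; u enters both, hence the power 2n
      of 1 + |u| below.\<close>
    define M where "M = (1 + 1 / d + \<bar>v\<bar> / l) * (1 + 1 / l)"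
    have "((1 + \<bar>x\<bar>) * (1 + \<bar>t\<bar>)) ^ n * exp (Re (Q (x, t)))
        \<le> M ^ n * (exp ((real n)\<^sup>2 / 2) * exp ((real (2 * n))\<^sup>2 / 2))" for x t
    proof -
      define y u where "y = d * (x + v * t)" and "u = l * t"
      have t: "t = u / l" and x: "x = y / d - v * u / l" using d l by (auto simp: y_def u_def field_simps)
      have "1 + \<bar>x\<bar> \<le> 1 + \<bar>y / d\<bar> + \<bar>v * u / l\<bar>" unfolding x using abs_triangle_ineq4[of "y / d" "v * u / l"] by simp
      also have "\<dots> \<le> (1 + 1 / d + \<bar>v\<bar> / l) * ((1 + \<bar>y\<bar>) * (1 + \<bar>u\<bar>))"
        using d l by (simp add: abs_mult algebra_simps)
      finally have 1: "1 + \<bar>x\<bar> \<le> (1 + 1 / d + \<bar>v\<bar> / l) * ((1 + \<bar>y\<bar>) * (1 + \<bar>u\<bar>))" .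
      have 2: "1 + \<bar>t\<bar> \<le> (1 + 1 / l) * (1 + \<bar>u\<bar>)" unfolding t using l by (simp add: algebra_simps)
      have "((1 + \<bar>x\<bar>) * (1 + \<bar>t\<bar>)) ^ n
        \<le> (((1 + 1 / d + \<bar>v\<bar> / l) * ((1 + \<bar>y\<bar>) * (1 + \<bar>u\<bar>))) * ((1 + 1 / l) * (1 + \<bar>u\<bar>))) ^ n"
        using d l by (intro power_mono mult_mono 1 2) auto
      also have "\<dots> = M ^ n * ((1 + \<bar>y\<bar>) ^ n * (1 + \<bar>u\<bar>) ^ (2 * n))"
        by (simp add: M_def power_mult_distrib mult_2 mult_2_right power_add mult_ac)
      finally have "((1 + \<bar>x\<bar>) * (1 + \<bar>t\<bar>)) ^ n * exp (Re (Q (x, t)))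
        \<le> M ^ n * ((1 + \<bar>y\<bar>) ^ n * (1 + \<bar>u\<bar>) ^ (2 * n)) * exp (Re (Q (x, t)))"
        by (intro mult_right_mono) auto
      also have ReQ: "Re (Q (x, t)) = - y\<^sup>2 / 2 + - u\<^sup>2 / 2"
        by (simp add: Q_def X_def y_def u_def power2_eq_square algebra_simps add_divide_distrib)
      also have "M ^ n * ((1 + \<bar>y\<bar>) ^ n * (1 + \<bar>u\<bar>) ^ (2 * n)) * exp (- y\<^sup>2 / 2 + - u\<^sup>2 / 2)
        = M ^ n * (((1 + \<bar>y\<bar>) ^ n * exp (- y\<^sup>2 / 2)) * ((1 + \<bar>u\<bar>) ^ (2 * n) * exp (- u\<^sup>2 / 2)))"
        unfolding exp_add by simp
      also have "\<dots> \<le> M ^ n * (exp ((real n)\<^sup>2 / 2) * exp ((real (2 * n))\<^sup>2 / 2))"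
        using d l by (intro mult_left_mono mult_mono power_times_gaussian_le) (auto simp: M_def)
      finally show ?thesis unfolding ReQ .
    qed
    thus ?thesis by blast
  qed
  ultimately show "gaussian_poly (wave_packet a c \<xi> \<tau> v d l)"
    unfolding gaussian_poly_def by blast
qed

section \<open>Fourier restriction norms of wave packets\<close>

lemma jbr_ge_1: "1 \<le> jbr x" and jbr_pos: "0 < jbr x" and jbr_nonneg: "0 \<le> jbr x"
  by (simp_all add: jbr_def add_pos_nonneg)

lemma jbr_minus: "jbr (- x) = jbr x"
  by (simp add: jbr_def)

lemma jbr_add_le: "jbr (x + y) \<le> jbr x * jbr y"
proof -
  have "jbr x * jbr y = 1 + \<bar>x\<bar> + \<bar>y\<bar> + \<bar>x\<bar> * \<bar>y\<bar>" by (simp add: jbr_def algebra_simps)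
  moreover have "0 \<le> \<bar>x\<bar> * \<bar>y\<bar>" by simp
  ultimately show ?thesis unfolding jbr_def using abs_triangle_ineq[of x y] by linarith
qed

text \<open>Peetre's inequality. For negative s, submultiplicativity is applied to x = (x + y) + (-
  y), which accounts for |s| on the second factor.\<close>

lemma jbr_powr_add_le: "jbr (x + y) powr s \<le> jbr x powr s * jbr y powr \<bar>s\<bar>"
proof (cases "0 \<le> s")
  case True
  have "jbr (x + y) powr s \<le> (jbr x * jbr y) powr s"
    using True jbr_add_le jbr_nonneg by (intro powr_mono2) auto
  thus ?thesis using True jbr_nonneg by (simp add: powr_mult)
next
  case False
  have "jbr x \<le> jbr (x + y) * jbr y"
    using jbr_add_le[of "x + y" "- y"] by (simp add: jbr_minus)
  hence "(jbr (x + y) * jbr y) powr s \<le> jbr x powr s"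
    using False jbr_pos by (intro powr_mono2') (auto simp: mult_pos_pos)
  hence "jbr (x + y) powr s * jbr y powr s * jbr y powr \<bar>s\<bar> \<le> jbr x powr s * jbr y powr \<bar>s\<bar>"
    using jbr_nonneg by (intro mult_right_mono) (auto simp: powr_mult)
  moreover have "jbr y powr s * jbr y powr \<bar>s\<bar> = 1"
    using False jbr_pos[of y] by (simp add: powr_add[symmetric])
  ultimately show ?thesis by (simp add: mult.assoc)
qed

text \<open>The sum of the absolute values of the coefficients, in the wave packet coordinates, of the
  cubic polynomial \<open>\<tau> - \<phi>(\<xi>)\<close>.\<close>

definition modulation_size :: "real \<Rightarrow> real \<Rightarrow> real \<Rightarrow> real \<Rightarrow> real \<Rightarrow> real \<Rightarrow> real \<Rightarrow> real" where
  "modulation_size \<alpha> \<beta> \<xi> \<tau> v d l = 1 + \<bar>\<tau> - phi \<alpha> \<beta> \<xi>\<bar> + \<bar>v - (3 * \<alpha> * \<xi>\<^sup>2 - \<beta>)\<bar> * d + l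
     + 3 * \<bar>\<alpha> * \<xi>\<bar> * d\<^sup>2 + \<bar>\<alpha>\<bar> * d ^ 3"

text \<open>The Taylor expansion of \<phi> at \<xi>, exact because \<phi> is cubic. The coefficient
  of \<eta> measures the mismatch between the slope of the packet and that of the curve.\<close>

lemma modulation_expand:
  "\<tau> + v * (d * \<eta>) + l * u - phi \<alpha> \<beta> (\<xi> + d * \<eta>)
    = (\<tau> - phi \<alpha> \<beta> \<xi>) + (v - (3 * \<alpha> * \<xi>\<^sup>2 - \<beta>)) * d * \<eta> + l * u
      - 3 * (\<alpha> * \<xi>) * d\<^sup>2 * \<eta>\<^sup>2 - \<alpha> * d ^ 3 * \<eta> ^ 3"
  by (simp add: phi_def algebra_simps power2_eq_square power3_eq_cube)

lemma modulation_size_ge_1: "0 \<le> d \<Longrightarrow> 0 \<le> l \<Longrightarrow> 1 \<le> modulation_size \<alpha> \<beta> \<xi> \<tau> v d l"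
  by (simp add: modulation_size_def)

text \<open>Each of the monomials 1, \<eta>, u, \<eta>^2, \<eta>^3 of the expansion is dominated by
  \<open>jbr \<eta> ^ 3 * jbr u\<close>.\<close>

lemma jbr_modulation_le:
  assumes "0 \<le> d" "0 \<le> l"
  shows "jbr (\<tau> + v * (d * \<eta>) + l * u - phi \<alpha> \<beta> (\<xi> + d * \<eta>))
    \<le> modulation_size \<alpha> \<beta> \<xi> \<tau> v d l * (jbr \<eta> ^ 3 * jbr u)"
proof -
  define X where "X = jbr \<eta> ^ 3 * jbr u"
  have X: "1 \<le> X" "\<bar>\<eta>\<bar> \<le> X" "\<eta>\<^sup>2 \<le> X" "\<bar>\<eta>\<bar> ^ 3 \<le> X" "\<bar>u\<bar> \<le> X"
  proof -
    have e: "1 \<le> jbr \<eta>" "\<bar>\<eta>\<bar> \<le> jbr \<eta>" "\<bar>u\<bar> \<le> jbr u" "1 \<le> jbr u" by (auto simp: jbr_def)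
    have 3: "jbr \<eta> ^ 3 \<le> X" unfolding X_def using e by (simp add: mult_le_cancel_left1)
    have "1 \<le> jbr \<eta> ^ 3" using e by simp
    thus "1 \<le> X" using 3 by simp
    have "\<bar>\<eta>\<bar> \<le> jbr \<eta> ^ 1" "jbr \<eta> ^ 1 \<le> jbr \<eta> ^ 3" using e power_increasing[of 1 3 "jbr \<eta>"] by auto
    thus "\<bar>\<eta>\<bar> \<le> X" using 3 by linarith
    have "\<bar>\<eta>\<bar>\<^sup>2 \<le> jbr \<eta> ^ 2" "jbr \<eta> ^ 2 \<le> jbr \<eta> ^ 3" using e power_increasing[of 2 3 "jbr \<eta>"] power_mono[of "\<bar>\<eta>\<bar>" "jbr \<eta>" 2] by auto
    thus "\<eta>\<^sup>2 \<le> X" using 3 by simp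
    have "\<bar>\<eta>\<bar> ^ 3 \<le> jbr \<eta> ^ 3" using e by (auto intro: power_mono)
    thus "\<bar>\<eta>\<bar> ^ 3 \<le> X" using 3 by linarith
    have "jbr u \<le> X" unfolding X_def using e \<open>1 \<le> jbr \<eta> ^ 3\<close> by (simp add: mult_le_cancel_right1)
    thus "\<bar>u\<bar> \<le> X" using e by linarith
  qed
  let ?m = "\<bar>v - (3 * \<alpha> * \<xi>\<^sup>2 - \<beta>)\<bar> * d"
  have "jbr (\<tau> + v * (d * \<eta>) + l * u - phi \<alpha> \<beta> (\<xi> + d * \<eta>))
     \<le> 1 + \<bar>\<tau> - phi \<alpha> \<beta> \<xi>\<bar> + \<bar>(v - (3 * \<alpha> * \<xi>\<^sup>2 - \<beta>)) * d * \<eta>\<bar> + \<bar>l * u\<bar>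
       + \<bar>3 * (\<alpha> * \<xi>) * d\<^sup>2 * \<eta>\<^sup>2\<bar> + \<bar>\<alpha> * d ^ 3 * \<eta> ^ 3\<bar>"
    unfolding modulation_expand jbr_def by linarith
  also have "\<dots> = 1 + \<bar>\<tau> - phi \<alpha> \<beta> \<xi>\<bar> + ?m * \<bar>\<eta>\<bar> + l * \<bar>u\<bar>
       + (3 * \<bar>\<alpha> * \<xi>\<bar> * d\<^sup>2) * \<eta>\<^sup>2 + (\<bar>\<alpha>\<bar> * d ^ 3) * \<bar>\<eta>\<bar> ^ 3"
    using assms by (simp add: abs_mult power_abs)
  also have "\<dots> \<le> 1 * X + \<bar>\<tau> - phi \<alpha> \<beta> \<xi>\<bar> * X + ?m * X + l * X + (3 * \<bar>\<alpha> * \<xi>\<bar> * d\<^sup>2) * X + (\<bar>\<alpha>\<bar> * d ^ 3) * X"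
    using assms X by (intro add_mono mult_left_mono) (auto simp: mult_le_cancel_left1)
  also have "\<dots> = modulation_size \<alpha> \<beta> \<xi> \<tau> v d l * X"
    by (simp add: modulation_size_def algebra_simps)
  finally show ?thesis unfolding X_def .
qed

text \<open>From ln(1 + |y|) <= |y| and p|y| <= p^2 + y^2/4: half of the Gaussian exponent absorbs
  any power weight, and the other half is left to be integrated.\<close>

lemma jbr_powr_gaussian_le: "jbr y powr p * exp (- y\<^sup>2 / 2) \<le> exp (p\<^sup>2) * exp (- y\<^sup>2 / 4)"
proof -
  have "ln (jbr y) \<le> \<bar>y\<bar>" "0 \<le> ln (jbr y)"
    using ln_add_one_self_le_self[of "\<bar>y\<bar>"] jbr_ge_1[of y] by (auto simp: jbr_def)
  hence "p * ln (jbr y) \<le> \<bar>p\<bar> * \<bar>y\<bar>"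
    by (meson abs_ge_self abs_ge_zero mult_mono order_trans)
  moreover have "0 \<le> (\<bar>p\<bar> - \<bar>y\<bar> / 2)\<^sup>2" by simp
  ultimately have "p * ln (jbr y) + - y\<^sup>2 / 2 \<le> p\<^sup>2 + - y\<^sup>2 / 4"
    by (simp add: power2_diff power_divide)
  thus ?thesis
    using jbr_pos[of y] by (simp add: powr_def exp_add[symmetric])
qed

section \<open>Norms as integrals in packet coordinates\<close>

lemma nn_integral_gaussian: "(\<integral>\<^sup>+ y. ennreal (exp (- y\<^sup>2 / 2)) \<partial>lborel) = ennreal (sqrt (2 * pi))"
proof -
  have "(\<integral>\<^sup>+ y. ennreal (exp (- y\<^sup>2 / 2)) \<partial>lborel)
     = (\<integral>\<^sup>+ y. ennreal (sqrt (2 * pi)) * ennreal (std_normal_density y) \<partial>lborel)"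
    by (intro nn_integral_cong) (simp add: std_normal_density_def ennreal_mult[symmetric])
  also have "\<dots> = ennreal (sqrt (2 * pi)) * (\<integral>\<^sup>+ y. ennreal (std_normal_density y) \<partial>lborel)"
    by (rule nn_integral_cmult) simp
  also have "(\<integral>\<^sup>+ y. ennreal (std_normal_density y) \<partial>lborel) = ennreal 1"
    by (subst nn_integral_eq_integral) (auto simp: integral_normal_density)
  finally show ?thesis by simp
qed

text \<open>By Tonelli the substitution is made one variable at a time: for fixed \<eta> the shear
  is merely a translation in the second variable, so the Jacobian is d l.\<close>

lemma nn_integral_shear_coords:
  fixes f :: "real \<times> real \<Rightarrow> ennreal"
  assumes "0 < d" "0 < l" and f [measurable]: "f \<in> borel_measurable borel"
  shows "(\<integral>\<^sup>+ p. f p \<partial>lborel)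
    = ennreal (d * l) * (\<integral>\<^sup>+ \<eta>. (\<integral>\<^sup>+ u. f (\<xi> + d * \<eta>, \<tau> + v * (d * \<eta>) + l * u) \<partial>lborel) \<partial>lborel)"
proof -
  have [measurable]: "(\<lambda>p. f (g p, h p)) \<in> borel_measurable M"
    if "g \<in> borel_measurable M" "h \<in> borel_measurable M" for g h :: "'b \<Rightarrow> real" and M
    using that by measurable
  have "(\<integral>\<^sup>+ p. f p \<partial>lborel) = (\<integral>\<^sup>+ x. (\<integral>\<^sup>+ y. f (x, y) \<partial>lborel) \<partial>lborel)"
    by (subst lborel.nn_integral_fst) (auto simp: lborel_prod)
  also have "\<dots> = ennreal d * (\<integral>\<^sup>+ \<eta>. (\<integral>\<^sup>+ y. f (\<xi> + d * \<eta>, y) \<partial>lborel) \<partial>lborel)"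
    using assms(1) by (subst nn_integral_real_affine[where c = d and t = \<xi>]) auto
  also have "(\<lambda>\<eta>. \<integral>\<^sup>+ y. f (\<xi> + d * \<eta>, y) \<partial>lborel)
     = (\<lambda>\<eta>. ennreal l * (\<integral>\<^sup>+ u. f (\<xi> + d * \<eta>, \<tau> + v * (d * \<eta>) + l * u) \<partial>lborel))"
  proof
    fix \<eta>
    show "(\<integral>\<^sup>+ y. f (\<xi> + d * \<eta>, y) \<partial>lborel)
       = ennreal l * (\<integral>\<^sup>+ u. f (\<xi> + d * \<eta>, \<tau> + v * (d * \<eta>) + l * u) \<partial>lborel)"
      using assms(2) by (subst nn_integral_real_affine[where c = l and t = "\<tau> + v * (d * \<eta>)"]) auto
  qed
  also have "(\<integral>\<^sup>+ \<eta>. ennreal l * (\<integral>\<^sup>+ u. f (\<xi> + d * \<eta>, \<tau> + v * (d * \<eta>) + l * u) \<partial>lborel) \<partial>lborel)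
     = ennreal l * (\<integral>\<^sup>+ \<eta>. (\<integral>\<^sup>+ u. f (\<xi> + d * \<eta>, \<tau> + v * (d * \<eta>) + l * u) \<partial>lborel) \<partial>lborel)"
    by (rule nn_integral_cmult) measurable
  finally show ?thesis
    using assms by (simp add: ennreal_mult mult.assoc)
qed

text \<open>Solving for the packet coordinates of an arbitrary point turns the formula for the
  transform into one valid everywhere, from which measurability can be read off.\<close>

lemma fourier2_wave_packet_measurable:
  assumes "0 < d" "0 < l"
  shows "fourier2 (wave_packet a c \<xi> \<tau> v d l) \<in> borel_measurable borel"
proof -
  let ?h = "\<lambda>p. (fst p - \<xi>) / d" and ?k = "\<lambda>p. (snd p - \<tau> - v * (fst p - \<xi>)) / l"
  have "fourier2 (wave_packet a c \<xi> \<tau> v d l) = (\<lambda>p. of_real (2 * pi / (d * l)) *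
     (a + \<i> * of_real (c * d * ?h p)) * of_real (exp (- ((?h p)\<^sup>2 + (?k p)\<^sup>2) / 2)))"
  proof
    fix p :: "real \<times> real"
    have "p = (\<xi> + d * ?h p, \<tau> + v * (d * ?h p) + l * ?k p)"
      using assms by (simp add: prod_eq_iff)
    thus "fourier2 (wave_packet a c \<xi> \<tau> v d l) p = of_real (2 * pi / (d * l)) *
      (a + \<i> * of_real (c * d * ?h p)) * of_real (exp (- ((?h p)\<^sup>2 + (?k p)\<^sup>2) / 2))"
      by (metis (no_types, lifting) fourier2_wave_packet[OF assms])
  qed
  also have "\<dots> \<in> borel_measurable borel"
    unfolding borel_prod[symmetric] by measurable
  finally show ?thesis .
qed

text \<open>The square of the norm before its conversion to a real number: monotonicity holds here
  without any finiteness.\<close>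

definition Xint :: "real \<Rightarrow> real \<Rightarrow> real \<Rightarrow> real \<Rightarrow> (real \<times> real \<Rightarrow> complex) \<Rightarrow> ennreal" where
  "Xint \<alpha> \<beta> s b w = (\<integral>\<^sup>+ p. ennreal
      ((jbr (fst p) powr s * jbr (snd p - phi \<alpha> \<beta> (fst p)) powr b * cmod (fourier2 w p))\<^sup>2) \<partial>lborel)"

text \<open>The squared height (2 pi/(d l))^2 times the Jacobian d l leaves the factor (2 pi)^2/(d
  l).\<close>

lemma Xint_wave_packet:
  assumes "0 < d" "0 < l"
  shows "Xint \<alpha> \<beta> s b (wave_packet a c \<xi> \<tau> v d l)
    = ennreal ((2 * pi)\<^sup>2 / (d * l)) * (\<integral>\<^sup>+ \<eta>. (\<integral>\<^sup>+ u. ennreal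
      ((jbr (\<xi> + d * \<eta>) powr s * jbr (\<tau> + v * (d * \<eta>) + l * u - phi \<alpha> \<beta> (\<xi> + d * \<eta>)) powr b
        * cmod (a + \<i> * of_real (c * d * \<eta>)))\<^sup>2 * exp (- (\<eta>\<^sup>2 + u\<^sup>2))) \<partial>lborel) \<partial>lborel)"
proof -
  define g where "g \<eta> u = (jbr (\<xi> + d * \<eta>) powr s
    * jbr (\<tau> + v * (d * \<eta>) + l * u - phi \<alpha> \<beta> (\<xi> + d * \<eta>)) powr b
    * cmod (a + \<i> * of_real (c * d * \<eta>)))\<^sup>2 * exp (- (\<eta>\<^sup>2 + u\<^sup>2))" for \<eta> u
  let ?C = "(2 * pi / (d * l))\<^sup>2"
  have [measurable]: "fourier2 (wave_packet a c \<xi> \<tau> v d l) \<in> borel_measurable (borel \<Otimes>\<^sub>M borel)"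
    using fourier2_wave_packet_measurable[OF assms] by (simp add: borel_prod)
  have [measurable]: "(\<lambda>p. ennreal ((jbr (fst p) powr s * jbr (snd p - phi \<alpha> \<beta> (fst p)) powr b
      * cmod (fourier2 (wave_packet a c \<xi> \<tau> v d l) p))\<^sup>2)) \<in> borel_measurable borel"
    unfolding jbr_def phi_def borel_prod[symmetric] by measurable
  have [measurable]: "(\<lambda>p. ennreal (g (fst p) (snd p))) \<in> borel_measurable borel"
    unfolding jbr_def phi_def g_def borel_prod[symmetric] by measurable
  have gm [measurable]: "(\<lambda>u. ennreal (g \<eta> u)) \<in> borel_measurable borel" for \<eta>
    unfolding jbr_def phi_def g_def by measurable
  have im: "(\<lambda>\<eta>. \<integral>\<^sup>+ u. ennreal (g \<eta> u) \<partial>lborel) \<in> borel_measurable lborel"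
    unfolding jbr_def phi_def g_def by measurable
  have *: "ennreal ((jbr (\<xi> + d * \<eta>) powr s
      * jbr (\<tau> + v * (d * \<eta>) + l * u - phi \<alpha> \<beta> (\<xi> + d * \<eta>)) powr b
      * cmod (fourier2 (wave_packet a c \<xi> \<tau> v d l) (\<xi> + d * \<eta>, \<tau> + v * (d * \<eta>) + l * u)))\<^sup>2)
    = ennreal ?C * ennreal (g \<eta> u)" for \<eta> u
  proof -
    have "cmod (fourier2 (wave_packet a c \<xi> \<tau> v d l) (\<xi> + d * \<eta>, \<tau> + v * (d * \<eta>) + l * u))
      = 2 * pi / (d * l) * cmod (a + \<i> * of_real (c * d * \<eta>)) * exp (- (\<eta>\<^sup>2 + u\<^sup>2) / 2)"
      unfolding fourier2_wave_packet[OF assms] norm_mult norm_of_real using assms by simp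
    moreover have "exp (- (\<eta>\<^sup>2 + u\<^sup>2)) = (exp (- (\<eta>\<^sup>2 + u\<^sup>2) / 2))\<^sup>2"
      by (simp add: exp_double[symmetric])
    ultimately show ?thesis
      by (simp only: g_def power_mult_distrib ennreal_mult[symmetric] zero_le_power2 mult_nonneg_nonneg)
         (simp only: mult_ac)
  qed
  have "Xint \<alpha> \<beta> s b (wave_packet a c \<xi> \<tau> v d l)
    = ennreal (d * l) * (\<integral>\<^sup>+ \<eta>. (\<integral>\<^sup>+ u. ennreal ?C * ennreal (g \<eta> u) \<partial>lborel) \<partial>lborel)"
    unfolding Xint_def
    by (subst nn_integral_shear_coords[OF assms, of _ \<xi> \<tau> v], measurable)
       (simp add: *)
  also have "\<dots> = ennreal (d * l) * (ennreal ?C * (\<integral>\<^sup>+ \<eta>. (\<integral>\<^sup>+ u. ennreal (g \<eta> u) \<partial>lborel) \<partial>lborel))"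
    using im by (simp add: nn_integral_cmult)
  also have "\<dots> = ennreal ((2 * pi)\<^sup>2 / (d * l)) * (\<integral>\<^sup>+ \<eta>. (\<integral>\<^sup>+ u. ennreal (g \<eta> u) \<partial>lborel) \<partial>lborel)"
    using assms by (simp add: mult.assoc[symmetric] ennreal_mult[symmetric] power_divide power2_eq_square)
  finally show ?thesis unfolding g_def .
qed

text \<open>For \<open>b < 0\<close> the modulation weight is only bounded by 1, hence the exponent \<open>max b 0\<close> below.\<close>

definition upper_const :: "real \<Rightarrow> real \<Rightarrow> real" where
  "upper_const s b = 2 * pi * sqrt (2 * pi) * 2 powr \<bar>s\<bar> * (exp ((\<bar>s\<bar> + 3 * max b 0 + 1)\<^sup>2) * exp ((max b 0)\<^sup>2))"

lemma Xint_wave_packet_le: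
  assumes d: "0 < d" "d \<le> 2" and l: "0 < l" and D: "0 \<le> D"
    and mult: "\<And>\<eta>. cmod (a + \<i> * of_real (c * d * \<eta>)) \<le> D * jbr \<eta>"
  shows "Xint \<alpha> \<beta> s b (wave_packet a c \<xi> \<tau> v d l)
    \<le> ennreal ((upper_const s b * D * jbr \<xi> powr s
        * modulation_size \<alpha> \<beta> \<xi> \<tau> v d l powr max b 0)\<^sup>2 / (d * l))"
proof -
  \<comment> \<open>The powers of \<open>jbr \<eta>\<close> and \<open>jbr u\<close> that
    accumulate: |s| from the frequency weight, three times \<open>max b 0\<close> from the cube in
    the modulation bound, 1 from the linear factor; u enters through the modulation only.\<close>
  let ?p = "\<bar>s\<bar> + 3 * max b 0 + 1" and ?q = "max b 0"
  define S where "S = modulation_size \<alpha> \<beta> \<xi> \<tau> v d l"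
  define K where "K = D * jbr \<xi> powr s * 2 powr \<bar>s\<bar> * S powr ?q * (exp (?p\<^sup>2) * exp (?q\<^sup>2))"
  have S: "1 \<le> S" unfolding S_def using d l by (intro modulation_size_ge_1) auto
  have pt: "(jbr (\<xi> + d * \<eta>) powr s * jbr (\<tau> + v * (d * \<eta>) + l * u - phi \<alpha> \<beta> (\<xi> + d * \<eta>)) powr b
        * cmod (a + \<i> * of_real (c * d * \<eta>)))\<^sup>2 * exp (- (\<eta>\<^sup>2 + u\<^sup>2))
      \<le> K\<^sup>2 * (exp (- \<eta>\<^sup>2 / 2) * exp (- u\<^sup>2 / 2))" (is "(?A * ?B * ?C)\<^sup>2 * _ \<le> _") for \<eta> u
  proof -
    have "jbr (d * \<eta>) \<le> 2 * jbr \<eta>"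
      using d mult_right_mono[of d 2 "\<bar>\<eta>\<bar>"] by (simp add: jbr_def abs_mult)
    hence "jbr (d * \<eta>) powr \<bar>s\<bar> \<le> (2 * jbr \<eta>) powr \<bar>s\<bar>"
      using jbr_nonneg by (intro powr_mono2) auto
    hence A: "?A \<le> jbr \<xi> powr s * (2 powr \<bar>s\<bar> * jbr \<eta> powr \<bar>s\<bar>)"
      using jbr_powr_add_le[of \<xi> "d * \<eta>" s] jbr_nonneg[of \<eta>]
      by (auto simp: powr_mult intro: order_trans[OF _ mult_left_mono])
    have cube: "(jbr \<eta> ^ 3) powr ?q = jbr \<eta> powr (3 * ?q)"
    proof -
      have "jbr \<eta> ^ 3 = jbr \<eta> powr 3" using jbr_pos[of \<eta>] by simp
      thus ?thesis by (simp only: powr_powr)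
    qed
    have "?B \<le> jbr (\<tau> + v * (d * \<eta>) + l * u - phi \<alpha> \<beta> (\<xi> + d * \<eta>)) powr ?q"
      using jbr_ge_1 by (intro powr_mono) auto
    also have "\<dots> \<le> (S * (jbr \<eta> ^ 3 * jbr u)) powr ?q"
      unfolding S_def using d l jbr_nonneg by (intro powr_mono2 jbr_modulation_le) auto
    also have "\<dots> = S powr ?q * (jbr \<eta> powr (3 * ?q) * jbr u powr ?q)"
      using S jbr_nonneg cube by (simp add: powr_mult)
    finally have B: "?B \<le> S powr ?q * (jbr \<eta> powr (3 * ?q) * jbr u powr ?q)" .
    have "?A * ?B * ?C \<le> (jbr \<xi> powr s * (2 powr \<bar>s\<bar> * jbr \<eta> powr \<bar>s\<bar>))
        * (S powr ?q * (jbr \<eta> powr (3 * ?q) * jbr u powr ?q)) * (D * jbr \<eta>)"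
      by (intro mult_mono A B mult) (use jbr_nonneg in auto)
    also have "\<dots> = (D * jbr \<xi> powr s * 2 powr \<bar>s\<bar> * S powr ?q) * (jbr \<eta> powr ?p * jbr u powr ?q)"
      using jbr_pos[of \<eta>] by (simp add: powr_add mult_ac)
    finally have "?A * ?B * ?C * (exp (- \<eta>\<^sup>2 / 2) * exp (- u\<^sup>2 / 2))
      \<le> (D * jbr \<xi> powr s * 2 powr \<bar>s\<bar> * S powr ?q) * (jbr \<eta> powr ?p * jbr u powr ?q)
         * (exp (- \<eta>\<^sup>2 / 2) * exp (- u\<^sup>2 / 2))"
      by (rule mult_right_mono) simp
    also have "\<dots> = (D * jbr \<xi> powr s * 2 powr \<bar>s\<bar> * S powr ?q) *
        ((jbr \<eta> powr ?p * exp (- \<eta>\<^sup>2 / 2)) * (jbr u powr ?q * exp (- u\<^sup>2 / 2)))"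
      by (simp only: mult_ac)
    also have "\<dots> \<le> (D * jbr \<xi> powr s * 2 powr \<bar>s\<bar> * S powr ?q) *
        ((exp (?p\<^sup>2) * exp (- \<eta>\<^sup>2 / 4)) * (exp (?q\<^sup>2) * exp (- u\<^sup>2 / 4)))"
      using D by (intro mult_left_mono mult_mono jbr_powr_gaussian_le) auto
    also have "\<dots> = K * (exp (- \<eta>\<^sup>2 / 4) * exp (- u\<^sup>2 / 4))"
      by (simp add: K_def)
    finally have "(?A * ?B * ?C * (exp (- \<eta>\<^sup>2 / 2) * exp (- u\<^sup>2 / 2)))\<^sup>2
        \<le> (K * (exp (- \<eta>\<^sup>2 / 4) * exp (- u\<^sup>2 / 4)))\<^sup>2"
      by (rule power_mono) simp
    moreover have "exp (- (\<eta>\<^sup>2 + u\<^sup>2)) = (exp (- \<eta>\<^sup>2 / 2) * exp (- u\<^sup>2 / 2))\<^sup>2"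
      by (simp add: power_mult_distrib exp_double[symmetric] exp_add[symmetric])
    moreover have "exp (- \<eta>\<^sup>2 / 2) * exp (- u\<^sup>2 / 2) = (exp (- \<eta>\<^sup>2 / 4) * exp (- u\<^sup>2 / 4))\<^sup>2"
      by (simp add: power_mult_distrib exp_double[symmetric])
    ultimately show ?thesis
      by (simp only: power_mult_distrib)
  qed
  have "(\<integral>\<^sup>+ \<eta>. (\<integral>\<^sup>+ u. ennreal
      ((jbr (\<xi> + d * \<eta>) powr s * jbr (\<tau> + v * (d * \<eta>) + l * u - phi \<alpha> \<beta> (\<xi> + d * \<eta>)) powr b
        * cmod (a + \<i> * of_real (c * d * \<eta>)))\<^sup>2 * exp (- (\<eta>\<^sup>2 + u\<^sup>2))) \<partial>lborel) \<partial>lborel)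
    \<le> (\<integral>\<^sup>+ \<eta>. (\<integral>\<^sup>+ u. ennreal (K\<^sup>2 * (exp (- \<eta>\<^sup>2 / 2) * exp (- u\<^sup>2 / 2))) \<partial>lborel) \<partial>lborel)"
    using pt by (intro nn_integral_mono ennreal_leI)
  also have "\<dots> = ennreal (K\<^sup>2) * (ennreal (sqrt (2 * pi)) * ennreal (sqrt (2 * pi)))"
    by (simp add: ennreal_mult nn_integral_cmult nn_integral_multc nn_integral_gaussian[simplified])
  also have "\<dots> = ennreal (K\<^sup>2 * (2 * pi))"
    by (simp add: ennreal_mult[symmetric])
  finally have "Xint \<alpha> \<beta> s b (wave_packet a c \<xi> \<tau> v d l)
      \<le> ennreal ((2 * pi)\<^sup>2 / (d * l)) * ennreal (K\<^sup>2 * (2 * pi))"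
    unfolding Xint_wave_packet[OF d(1) l] by (rule mult_left_mono) simp
  also have "\<dots> = ennreal ((2 * pi)\<^sup>2 / (d * l) * (K\<^sup>2 * (2 * pi)))"
    by (rule ennreal_mult[symmetric]) (use d l in auto)
  also have "(2 * pi)\<^sup>2 / (d * l) * (K\<^sup>2 * (2 * pi)) = (2 * pi * sqrt (2 * pi) * K)\<^sup>2 / (d * l)"
    by (simp add: power_mult_distrib)
  also have "2 * pi * sqrt (2 * pi) * K = upper_const s b * D * jbr \<xi> powr s * S powr max b 0"
    by (simp add: K_def upper_const_def)
  finally show ?thesis unfolding S_def .
qed

lemma Xnorm_conv_Xint: "Xnorm \<alpha> \<beta> s b w = sqrt (enn2real (Xint \<alpha> \<beta> s b w))"
  by (simp add: Xnorm_def Xint_def)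

lemma Xnorm_wave_packet_le:
  assumes d: "0 < d" "d \<le> 2" and l: "0 < l"
  shows "Xnorm \<alpha> \<beta> s b (wave_packet 1 0 \<xi> \<tau> v d l)
    \<le> upper_const s b * jbr \<xi> powr s * modulation_size \<alpha> \<beta> \<xi> \<tau> v d l powr max b 0 / sqrt (d * l)"
proof -
  let ?R = "upper_const s b * jbr \<xi> powr s * modulation_size \<alpha> \<beta> \<xi> \<tau> v d l powr max b 0"
  have R: "0 \<le> ?R" by (simp add: upper_const_def)
  have "Xint \<alpha> \<beta> s b (wave_packet 1 0 \<xi> \<tau> v d l) \<le> ennreal (?R\<^sup>2 / (d * l))"
    using Xint_wave_packet_le[OF assms, of 1 1 0] jbr_ge_1 by simp
  hence "enn2real (Xint \<alpha> \<beta> s b (wave_packet 1 0 \<xi> \<tau> v d l)) \<le> ?R\<^sup>2 / (d * l)"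
    using d l by (intro enn2real_leI) auto
  hence "Xnorm \<alpha> \<beta> s b (wave_packet 1 0 \<xi> \<tau> v d l) \<le> sqrt (?R\<^sup>2 / (d * l))"
    unfolding Xnorm_conv_Xint by (rule real_sqrt_le_mono)
  also have "\<dots> = ?R / sqrt (d * l)"
    using R by (simp add: real_sqrt_divide)
  finally show ?thesis .
qed

text \<open>The integral is restricted to a rectangle of area 1 on which \<eta>^2 + u^2 <= 5. The
  rectangle stays away from \<eta> = 0 because, for opposite input frequencies, the derivative of
  the product vanishes there and the output modulation can be small.\<close>

lemma Xnorm_wave_packet_ge:
  assumes d: "0 < d" "d \<le> 2" and l: "0 < l" and P: "0 \<le> P"
    and le: "\<And>\<eta> u. 1 \<le> \<eta> \<Longrightarrow> \<eta> \<le> 2 \<Longrightarrow> 0 \<le> u \<Longrightarrow> u \<le> 1 \<Longrightarrow>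
      P \<le> jbr (\<xi> + d * \<eta>) powr s * jbr (\<tau> + v * (d * \<eta>) + l * u - phi \<alpha> \<beta> (\<xi> + d * \<eta>)) powr b
        * cmod (a + \<i> * of_real (c * d * \<eta>))"
  shows "2 * pi * exp (- 5 / 2) * P / sqrt (d * l) \<le> Xnorm \<alpha> \<beta> s b (wave_packet a c \<xi> \<tau> v d l)"
proof -
  have "cmod (a + \<i> * of_real (c * d * \<eta>)) \<le> (cmod a + \<bar>c\<bar> * d) * jbr \<eta>" for \<eta>
  proof -
    have "cmod (a + \<i> * of_real (c * d * \<eta>)) \<le> cmod a + \<bar>c\<bar> * d * \<bar>\<eta>\<bar>"
      using norm_triangle_ineq[of a "\<i> * of_real (c * d * \<eta>)"] d by (simp add: norm_mult abs_mult mult_ac)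
    also have "\<dots> \<le> cmod a * jbr \<eta> + \<bar>c\<bar> * d * jbr \<eta>"
      using d by (intro add_mono mult_left_mono) (auto simp: jbr_def mult_le_cancel_left1)
    finally show ?thesis by (simp add: distrib_right)
  qed
  \<comment> \<open>The lower bound needs finiteness, since \<open>enn2real \<infinity> = 0\<close>.\<close>
  hence fin: "Xint \<alpha> \<beta> s b (wave_packet a c \<xi> \<tau> v d l) < \<top>"
    using d by (intro le_less_trans[OF Xint_wave_packet_le[OF d l, where D = "cmod a + \<bar>c\<bar> * d"] ennreal_less_top]) auto
  have "ennreal (P\<^sup>2 * exp (- 5)) = ennreal (P\<^sup>2 * exp (- 5)) * (emeasure lborel {1..2::real} * emeasure lborel {0..1::real})"
    by simp
  also have "\<dots> = (\<integral>\<^sup>+ \<eta>. (\<integral>\<^sup>+ u. ennreal (P\<^sup>2 * exp (- 5)) * (indicator {1..2::real} \<eta> * indicator {0..1::real} u) \<partial>lborel) \<partial>lborel)"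
    by (simp add: nn_integral_cmult nn_integral_multc)
  also have "\<dots> \<le> (\<integral>\<^sup>+ \<eta>. (\<integral>\<^sup>+ u. ennreal
      ((jbr (\<xi> + d * \<eta>) powr s * jbr (\<tau> + v * (d * \<eta>) + l * u - phi \<alpha> \<beta> (\<xi> + d * \<eta>)) powr b
        * cmod (a + \<i> * of_real (c * d * \<eta>)))\<^sup>2 * exp (- (\<eta>\<^sup>2 + u\<^sup>2))) \<partial>lborel) \<partial>lborel)"
  proof (intro nn_integral_mono)
    fix \<eta> u :: real
    let ?X = "jbr (\<xi> + d * \<eta>) powr s * jbr (\<tau> + v * (d * \<eta>) + l * u - phi \<alpha> \<beta> (\<xi> + d * \<eta>)) powr b
        * cmod (a + \<i> * of_real (c * d * \<eta>))"
    show "ennreal (P\<^sup>2 * exp (- 5)) * (indicator {1..2::real} \<eta> * indicator {0..1::real} u)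
      \<le> ennreal (?X\<^sup>2 * exp (- (\<eta>\<^sup>2 + u\<^sup>2)))"
    proof (cases "\<eta> \<in> {1..2} \<and> u \<in> {0..1}")
      case True
      hence "P\<^sup>2 \<le> ?X\<^sup>2" using P by (intro power_mono le) auto
      moreover have "\<eta>\<^sup>2 \<le> 2\<^sup>2" "u\<^sup>2 \<le> 1\<^sup>2" using True power_mono[of \<eta> 2 2] power_mono[of u 1 2] by auto
      ultimately have "P\<^sup>2 * exp (- 5) \<le> ?X\<^sup>2 * exp (- (\<eta>\<^sup>2 + u\<^sup>2))"
        by (intro mult_mono) auto
      thus ?thesis using True by (simp add: ennreal_leI)
    qed (auto simp: indicator_def)
  qed
  finally have "ennreal ((2 * pi)\<^sup>2 / (d * l)) * ennreal (P\<^sup>2 * exp (- 5)) \<le> Xint \<alpha> \<beta> s b (wave_packet a c \<xi> \<tau> v d l)"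
    unfolding Xint_wave_packet[OF d(1) l] by (rule mult_left_mono) simp
  hence "ennreal ((2 * pi)\<^sup>2 / (d * l) * (P\<^sup>2 * exp (- 5))) \<le> Xint \<alpha> \<beta> s b (wave_packet a c \<xi> \<tau> v d l)"
    by (subst ennreal_mult) (use d l in auto)
  hence "(2 * pi)\<^sup>2 / (d * l) * (P\<^sup>2 * exp (- 5)) \<le> enn2real (Xint \<alpha> \<beta> s b (wave_packet a c \<xi> \<tau> v d l))"
    using fin d l enn2real_mono by fastforce
  hence "sqrt ((2 * pi)\<^sup>2 / (d * l) * (P\<^sup>2 * exp (- 5))) \<le> Xnorm \<alpha> \<beta> s b (wave_packet a c \<xi> \<tau> v d l)"
    unfolding Xnorm_conv_Xint by (rule real_sqrt_le_mono)
  moreover have "sqrt ((2 * pi)\<^sup>2 / (d * l) * (P\<^sup>2 * exp (- 5))) = 2 * pi * exp (- 5 / 2) * P / sqrt (d * l)"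
  proof -
    have "(exp (- 5 / 2))\<^sup>2 = exp (- 5 :: real)" by (simp add: exp_double[symmetric])
    hence e: "(2 * pi)\<^sup>2 / (d * l) * (P\<^sup>2 * exp (- 5)) = (2 * pi * exp (- 5 / 2) * P)\<^sup>2 / (d * l)"
      by (simp add: power_mult_distrib)
    show ?thesis unfolding e using P by (simp add: real_sqrt_divide)
  qed
  ultimately show ?thesis by simp
qed

section \<open>Bilinear estimates on wave packets\<close>

text \<open>What the three products have in common, so that each counterexample is proved once for
  all of them: \<open>m\<close> is the multiplier at the two centres and \<open>c\<close> its rate
  of change across the product packet. The bounds on \<open>c\<close> keep that change
  controlled.\<close>

definition packet_multiplier ::
  "((real \<times> real \<Rightarrow> complex) \<Rightarrow> (real \<times> real \<Rightarrow> complex) \<Rightarrow> real \<times> real \<Rightarrow> complex)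
    \<Rightarrow> (real \<Rightarrow> real \<Rightarrow> real) \<Rightarrow> real \<Rightarrow> bool" where
  "packet_multiplier T m c \<longleftrightarrow> 0 \<le> c \<and> c \<le> 1 \<and> (\<forall>\<xi> \<tau> \<xi>' \<tau>' v d l.
     T (wave_packet 1 0 \<xi> \<tau> v d l) (wave_packet 1 0 \<xi>' \<tau>' v d l)
       = wave_packet (\<i> * of_real (m \<xi> \<xi>')) c (\<xi> + \<xi>') (\<tau> + \<tau>') v (sqrt 2 * d) (sqrt 2 * l))"

lemma packet_multiplier_divergence:
  "packet_multiplier (\<lambda>w1 w2. pdx (\<lambda>z. w1 z * w2 z)) (\<lambda>\<xi> \<xi>'. \<xi> + \<xi>') 1"
  by (simp add: packet_multiplier_def wave_packet_mult pdx_wave_packet)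

lemma packet_multiplier_left:
  "packet_multiplier (\<lambda>w1 w2 z. pdx w1 z * w2 z) (\<lambda>\<xi> \<xi>'. \<xi>) (1 / 2)"
  by (simp add: packet_multiplier_def wave_packet_mult pdx_wave_packet)

lemma packet_multiplier_right:
  "packet_multiplier (\<lambda>w1 w2 z. w1 z * pdx w2 z) (\<lambda>\<xi> \<xi>'. \<xi>') (1 / 2)"
proof -
  have "wave_packet 1 0 \<xi> \<tau> v d l z * wave_packet a c \<xi>' \<tau>' v d l z
    = wave_packet a (c / 2) (\<xi> + \<xi>') (\<tau> + \<tau>') v (sqrt 2 * d) (sqrt 2 * l) z"
    for a c \<xi> \<tau> \<xi>' \<tau>' v d l z
    using wave_packet_mult[of a c \<xi>' \<tau>' v d l z \<xi> \<tau>] by (simp add: add.commute mult.commute)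
  thus ?thesis
    by (simp add: packet_multiplier_def pdx_wave_packet)
qed

text \<open>Separate parameters for the output and the two inputs cover all types: (D1) is the
  triple \<alpha>2, \<alpha>1, \<alpha>1 and the others are \<alpha>1, \<alpha>1, \<alpha>2.\<close>

definition bilinear_estimate ::
  "((real \<times> real \<Rightarrow> complex) \<Rightarrow> (real \<times> real \<Rightarrow> complex) \<Rightarrow> real \<times> real \<Rightarrow> complex)
    \<Rightarrow> real \<Rightarrow> real \<Rightarrow> real \<Rightarrow> real \<Rightarrow> real \<Rightarrow> real \<Rightarrow> bool" where
  "bilinear_estimate T \<alpha>0 \<alpha>1 \<alpha>2 \<beta> s b \<longleftrightarrow> (\<exists>C. \<forall>w1 w2. schwartz w1 \<longrightarrow> schwartz w2 \<longrightarrow>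
     Xnorm \<alpha>0 \<beta> s (b - 1) (T w1 w2) \<le> C * Xnorm \<alpha>1 \<beta> s b w1 * Xnorm \<alpha>2 \<beta> s b w2)"

text \<open>One factor 1/sqrt(d l) on the left against two on the right leaves sqrt(d l) on the
  left. \<open>P\<close> bounds the output weight from below on the rectangle used for lower bounds;
  the ranges of \<theta> and u have room for the dilation of the product packet by sqrt 2.\<close>

lemma bilinear_estimate_wave_packets:
  assumes "bilinear_estimate T \<alpha>0 \<alpha>1 \<alpha>2 \<beta> s b" and T: "packet_multiplier T m c"
  obtains C where "0 \<le> C" "\<And>\<xi>1 \<tau>1 \<xi>2 \<tau>2 v d l P. 0 < d \<Longrightarrow> d \<le> 1 \<Longrightarrow> 0 < l \<Longrightarrow> 0 \<le> P \<Longrightarrow>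
    (\<And>\<theta> u. 1 \<le> \<theta> \<Longrightarrow> \<theta> \<le> 4 \<Longrightarrow> 0 \<le> u \<Longrightarrow> u \<le> 2 \<Longrightarrow>
      P \<le> jbr (\<xi>1 + \<xi>2 + d * \<theta>) powr s
        * jbr (\<tau>1 + \<tau>2 + v * (d * \<theta>) + l * u - phi \<alpha>0 \<beta> (\<xi>1 + \<xi>2 + d * \<theta>)) powr (b - 1)
        * \<bar>m \<xi>1 \<xi>2 + c * d * \<theta>\<bar>) \<Longrightarrow>
    P * sqrt (d * l) \<le> C * (jbr \<xi>1 powr s * modulation_size \<alpha>1 \<beta> \<xi>1 \<tau>1 v d l powr max b 0)
      * (jbr \<xi>2 powr s * modulation_size \<alpha>2 \<beta> \<xi>2 \<tau>2 v d l powr max b 0)"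
proof -
  from assms(1) obtain C where C: "\<And>w1 w2. schwartz w1 \<Longrightarrow> schwartz w2 \<Longrightarrow>
     Xnorm \<alpha>0 \<beta> s (b - 1) (T w1 w2) \<le> C * Xnorm \<alpha>1 \<beta> s b w1 * Xnorm \<alpha>2 \<beta> s b w2"
    unfolding bilinear_estimate_def by blast
  define U where "U = upper_const s b"
  have U: "0 \<le> U" by (simp add: U_def upper_const_def)
  define k where "k = 2 * pi * exp (- 5 / 2) / sqrt 2"
  have k: "0 < k" by (simp add: k_def)
  have Xnorm_nonneg: "0 \<le> Xnorm \<alpha> \<beta> s b w" for \<alpha> \<beta> s b w
    by (simp add: Xnorm_def)
  show thesis
  \<comment> \<open>The given constant may be negative, hence the absolute value. \<open>U\<close>
    enters once per input norm, and \<open>k\<close> collects the constants of the lower bound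
    together with the sqrt 2 of the dilation.\<close>
  proof (rule that[of "\<bar>C\<bar> * U\<^sup>2 / k"])
    show "0 \<le> \<bar>C\<bar> * U\<^sup>2 / k" using k by simp
    fix \<xi>1 \<tau>1 \<xi>2 \<tau>2 v d l P :: real
    assume d: "0 < d" "d \<le> 1" and l: "0 < l" and P: "0 \<le> P"
      and le: "\<And>\<theta> u. 1 \<le> \<theta> \<Longrightarrow> \<theta> \<le> 4 \<Longrightarrow> 0 \<le> u \<Longrightarrow> u \<le> 2 \<Longrightarrow>
      P \<le> jbr (\<xi>1 + \<xi>2 + d * \<theta>) powr s
        * jbr (\<tau>1 + \<tau>2 + v * (d * \<theta>) + l * u - phi \<alpha>0 \<beta> (\<xi>1 + \<xi>2 + d * \<theta>)) powr (b - 1)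
        * \<bar>m \<xi>1 \<xi>2 + c * d * \<theta>\<bar>"
    let ?w1 = "wave_packet 1 0 \<xi>1 \<tau>1 v d l" and ?w2 = "wave_packet 1 0 \<xi>2 \<tau>2 v d l"
    let ?A = "jbr \<xi>1 powr s * modulation_size \<alpha>1 \<beta> \<xi>1 \<tau>1 v d l powr max b 0"
    let ?B = "jbr \<xi>2 powr s * modulation_size \<alpha>2 \<beta> \<xi>2 \<tau>2 v d l powr max b 0"
    have s2: "1 \<le> sqrt 2" "sqrt 2 \<le> 2" by (auto intro: real_le_lsqrt)
    have sd: "sqrt 2 * d \<le> 2" using s2 d mult_mono[of "sqrt 2" 2 d 1] by simp
    have "2 * pi * exp (- 5 / 2) * P / sqrt ((sqrt 2 * d) * (sqrt 2 * l))
      \<le> Xnorm \<alpha>0 \<beta> s (b - 1) (wave_packet (\<i> * of_real (m \<xi>1 \<xi>2)) c (\<xi>1 + \<xi>2) (\<tau>1 + \<tau>2) v (sqrt 2 * d) (sqrt 2 * l))"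
    proof (rule Xnorm_wave_packet_ge)
      fix \<eta> u :: real
      assume \<eta>: "1 \<le> \<eta>" "\<eta> \<le> 2" and u: "0 \<le> u" "u \<le> 1"
      have "cmod (\<i> * of_real (m \<xi>1 \<xi>2) + \<i> * of_real (c * (sqrt 2 * d) * \<eta>)) = \<bar>m \<xi>1 \<xi>2 + c * d * (sqrt 2 * \<eta>)\<bar>"
      proof -
        have "\<i> * of_real (m \<xi>1 \<xi>2) + \<i> * of_real (c * (sqrt 2 * d) * \<eta>) = \<i> * of_real (m \<xi>1 \<xi>2 + c * d * (sqrt 2 * \<eta>))"
          by (simp add: algebra_simps)
        thus ?thesis by (simp only: norm_mult norm_ii norm_of_real mult_1_left)
      qed
      moreover have "1 \<le> sqrt 2 * \<eta>" "sqrt 2 * \<eta> \<le> 4" "0 \<le> sqrt 2 * u" "sqrt 2 * u \<le> 2"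
        using s2 \<eta> u mult_mono[of 1 "sqrt 2" 1 \<eta>] mult_mono[of "sqrt 2" 2 \<eta> 2] mult_mono[of "sqrt 2" 2 u 1] by auto
      ultimately show "P \<le> jbr (\<xi>1 + \<xi>2 + sqrt 2 * d * \<eta>) powr s
          * jbr (\<tau>1 + \<tau>2 + v * (sqrt 2 * d * \<eta>) + sqrt 2 * l * u - phi \<alpha>0 \<beta> (\<xi>1 + \<xi>2 + sqrt 2 * d * \<eta>)) powr (b - 1)
          * cmod (\<i> * of_real (m \<xi>1 \<xi>2) + \<i> * of_real (c * (sqrt 2 * d) * \<eta>))"
        using le[of "sqrt 2 * \<eta>" "sqrt 2 * u"] by (simp add: mult_ac)
    qed (use d l P sd in auto)
    also have "\<dots> = Xnorm \<alpha>0 \<beta> s (b - 1) (T ?w1 ?w2)"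
      using T by (simp add: packet_multiplier_def)
    also have "\<dots> \<le> C * Xnorm \<alpha>1 \<beta> s b ?w1 * Xnorm \<alpha>2 \<beta> s b ?w2"
      by (intro C schwartz_wave_packet d l)
    also have "\<dots> \<le> \<bar>C\<bar> * (Xnorm \<alpha>1 \<beta> s b ?w1 * Xnorm \<alpha>2 \<beta> s b ?w2)"
      using Xnorm_nonneg by (simp add: mult.assoc mult_right_mono)
    also have "\<dots> \<le> \<bar>C\<bar> * ((U * ?A / sqrt (d * l)) * (U * ?B / sqrt (d * l)))"
      using d l U Xnorm_wave_packet_le[of d l \<alpha>1 \<beta> s b \<xi>1 \<tau>1 v] Xnorm_wave_packet_le[of d l \<alpha>2 \<beta> s b \<xi>2 \<tau>2 v]
      by (intro mult_left_mono mult_mono) (auto simp: U_def mult.assoc Xnorm_nonneg)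
    also have "\<dots> = \<bar>C\<bar> * U\<^sup>2 * ?A * ?B / (sqrt (d * l) * sqrt (d * l))"
      by (simp add: power2_eq_square mult_ac)
    finally have "k * P / sqrt (d * l) \<le> \<bar>C\<bar> * U\<^sup>2 * ?A * ?B / (sqrt (d * l) * sqrt (d * l))"
      using d l by (simp add: k_def real_sqrt_mult mult_ac)
    moreover have "k * (P * r) \<le> Y" if "k * P / r \<le> Y / (r * r)" "0 < r" for r Y
      using that by (simp add: field_simps)
    ultimately have "k * (P * sqrt (d * l)) \<le> \<bar>C\<bar> * U\<^sup>2 * ?A * ?B"
      using d l by (meson mult_pos_pos real_sqrt_gt_zero)
    thus "P * sqrt (d * l) \<le> \<bar>C\<bar> * U\<^sup>2 / k * ?A * ?B"
      using k by (simp add: field_simps)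
  qed
qed

section \<open>Failure of an estimate as a comparison of exponents of N\<close>

text \<open>The minimum and maximum handle both signs of the exponent at once; the lemma is applied
  with s and with b - 1.\<close>

lemma powr_between:
  fixes A B M y s :: real
  assumes "0 < A" "0 < M" "A * M \<le> y" "y \<le> B * M"
  shows "min (A powr s) (B powr s) * M powr s \<le> y powr s"
    and "y powr s \<le> max (A powr s) (B powr s) * M powr s"
proof -
  have "0 < A * M" using assms by simp
  hence y: "0 < y" and "0 < B * M" using assms by linarith+
  hence B: "0 < B" using assms by (simp add: zero_less_mult_iff)
  have split: "(A * M) powr s = A powr s * M powr s" "(B * M) powr s = B powr s * M powr s"
    using assms B by (simp_all add: powr_mult)
  have "min (A powr s) (B powr s) * M powr s \<le> y powr s \<and> y powr s \<le> max (A powr s) (B powr s) * M powr s"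
  proof (cases "0 \<le> s")
    case True
    hence "(A * M) powr s \<le> y powr s" "y powr s \<le> (B * M) powr s"
      using assms y by (auto intro!: powr_mono2)
    moreover have "min (A powr s) (B powr s) * M powr s \<le> A powr s * M powr s"
      "B powr s * M powr s \<le> max (A powr s) (B powr s) * M powr s"
      by (auto intro!: mult_right_mono)
    ultimately show ?thesis unfolding split by linarith
  next
    case False
    hence "y powr s \<le> (A * M) powr s" "(B * M) powr s \<le> y powr s"
      using assms y by (auto intro!: powr_mono2')
    moreover have "min (A powr s) (B powr s) * M powr s \<le> B powr s * M powr s"
      "A powr s * M powr s \<le> max (A powr s) (B powr s) * M powr s"
      by (auto intro!: mult_right_mono)
    ultimately show ?thesis unfolding split by linarith
  qed
  thus "min (A powr s) (B powr s) * M powr s \<le> y powr s" "y powr s \<le> max (A powr s) (B powr s) * M powr s"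
    by auto
qed

lemma powr_unbounded:
  fixes C e N0 :: real
  assumes "0 < e"
  shows "\<exists>N\<ge>N0. 1 \<le> N \<and> C < N powr e"
proof -
  define N where "N = max N0 (max 1 ((\<bar>C\<bar> + 1) powr (1 / e)))"
  have "C < ((\<bar>C\<bar> + 1) powr (1 / e)) powr e" using assms by (simp add: powr_powr)
  also have "\<dots> \<le> N powr e" using assms by (intro powr_mono2) (auto simp: N_def)
  finally show ?thesis by (intro exI[of _ N]) (auto simp: N_def)
qed

text \<open>The power count. Input i has weight N^(s + ai max(b,0)); the output has N^s from its
  frequency, or a bounded factor if the frequencies cancel, N^g from the derivative and N^(h(b-1))
  from the modulation; sqrt(d l) is N^((q-p)/2). The output modulation is bounded on both sides
  since b - 1 may have either sign.\<close>

lemma not_bilinear_estimate: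
  fixes \<tau>1 \<tau>2 v :: "real \<Rightarrow> real"
  assumes T: "packet_multiplier T m c"
    and x: "x1 \<noteq> 0" "x2 \<noteq> 0" and "0 \<le> p" and K: "0 < K"
    and in1: "\<And>N. N \<ge> N0 \<Longrightarrow> modulation_size \<alpha>1 \<beta> (x1 * N) (\<tau>1 N) (v N) (N powr - p) (N powr q) \<le> K * N powr a1"
    and in2: "\<And>N. N \<ge> N0 \<Longrightarrow> modulation_size \<alpha>2 \<beta> (x2 * N) (\<tau>2 N) (v N) (N powr - p) (N powr q) \<le> K * N powr a2"
    and out: "\<And>N. N \<ge> N0 \<Longrightarrow> modulation_size \<alpha>0 \<beta> ((x1 + x2) * N) (\<tau>1 N + \<tau>2 N) (v N) (N powr - p) (N powr q) \<le> K * N powr h"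
    and low: "\<And>N \<theta> u. N \<ge> N0 \<Longrightarrow> 1 \<le> \<theta> \<Longrightarrow> \<theta> \<le> 4 \<Longrightarrow> 0 \<le> u \<Longrightarrow> u \<le> 2 \<Longrightarrow>
      N powr h \<le> K * jbr (\<tau>1 N + \<tau>2 N + v N * (N powr - p * \<theta>) + N powr q * u - phi \<alpha>0 \<beta> ((x1 + x2) * N + N powr - p * \<theta>))"
    and mult: "\<And>N \<theta>. N \<ge> N0 \<Longrightarrow> 1 \<le> \<theta> \<Longrightarrow> \<theta> \<le> 4 \<Longrightarrow>
      N powr g \<le> K * \<bar>m (x1 * N) (x2 * N) + c * N powr - p * \<theta>\<bar>"
    and exponent: "2 * s + (a1 + a2) * max b 0 < (q - p) / 2 + (if x1 + x2 = 0 then 0 else s) + g + h * (b - 1)"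
  shows "\<not> bilinear_estimate T \<alpha>0 \<alpha>1 \<alpha>2 \<beta> s b"
proof
  assume "bilinear_estimate T \<alpha>0 \<alpha>1 \<alpha>2 \<beta> s b"
  from bilinear_estimate_wave_packets[OF this T] obtain C where C: "0 \<le> C"
    and est: "\<And>\<xi>1 \<tau>1 \<xi>2 \<tau>2 v d l P. 0 < d \<Longrightarrow> d \<le> 1 \<Longrightarrow> 0 < l \<Longrightarrow> 0 \<le> P \<Longrightarrow>
    (\<And>\<theta> u. 1 \<le> \<theta> \<Longrightarrow> \<theta> \<le> 4 \<Longrightarrow> 0 \<le> u \<Longrightarrow> u \<le> 2 \<Longrightarrow>
      P \<le> jbr (\<xi>1 + \<xi>2 + d * \<theta>) powr s
        * jbr (\<tau>1 + \<tau>2 + v * (d * \<theta>) + l * u - phi \<alpha>0 \<beta> (\<xi>1 + \<xi>2 + d * \<theta>)) powr (b - 1)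
        * \<bar>m \<xi>1 \<xi>2 + c * d * \<theta>\<bar>) \<Longrightarrow>
    P * sqrt (d * l) \<le> C * (jbr \<xi>1 powr s * modulation_size \<alpha>1 \<beta> \<xi>1 \<tau>1 v d l powr max b 0)
      * (jbr \<xi>2 powr s * modulation_size \<alpha>2 \<beta> \<xi>2 \<tau>2 v d l powr max b 0)"
    by metis
  let ?e0 = "if x1 + x2 = 0 then 0 else s"
  define lo hi where "lo x = min (\<bar>x\<bar> powr s) ((1 + \<bar>x\<bar>) powr s)" and "hi x = max (\<bar>x\<bar> powr s) ((1 + \<bar>x\<bar>) powr s)" for x :: real
  \<comment> \<open>As d \<theta> <= 4, moving from the centre to a point of the packet changes the
    frequency weight by at most 5^|s|. The 375 in the next definition is 5^3 * 3, from \<theta> <= 4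
    and u <= 2 in the modulation bound.\<close>
  define lo0 where "lo0 = (if x1 + x2 = 0 then 1 else lo (x1 + x2)) * 5 powr - \<bar>s\<bar>"
  define loh where "loh = min ((1 / K) powr (b - 1)) ((K * 375) powr (b - 1))"
  define k where "k = lo0 * loh / K"
  define C' where "C' = C * (hi x1 * K powr max b 0) * (hi x2 * K powr max b 0)"
  have k: "0 < k" using K by (auto simp: k_def lo0_def loh_def lo_def)
  have jbr_freq: "lo x * N powr s \<le> jbr (x * N) powr s" "jbr (x * N) powr s \<le> hi x * N powr s"
    if "x \<noteq> 0" "1 \<le> N" for x N
    using that powr_between[of "\<bar>x\<bar>" N "jbr (x * N)" "1 + \<bar>x\<bar>" s]
    by (auto simp: lo_def hi_def jbr_def abs_mult distrib_right)
  have hi0: "0 \<le> hi x" for x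
    by (simp add: hi_def le_max_iff_disj)
  have main: "k * N powr (?e0 + h * (b - 1) + g) * N powr ((q - p) / 2)
      \<le> C' * N powr (2 * s + (a1 + a2) * max b 0)" if N: "N0 \<le> N" "1 \<le> N" for N
  proof -
    define d l where "d = N powr - p" and "l = N powr q"
    have d: "0 < d" "d \<le> 1" and l: "0 < l"
      using N \<open>0 \<le> p\<close> powr_mono[of "- p" 0 N] by (auto simp: d_def l_def)
    define P where "P = (lo0 * N powr ?e0) * (loh * N powr (h * (b - 1))) * (N powr g / K)"
    have P: "0 \<le> P" using K by (auto simp: P_def lo0_def loh_def lo_def)
    have "P * sqrt (d * l) \<le> C * (jbr (x1 * N) powr s * modulation_size \<alpha>1 \<beta> (x1 * N) (\<tau>1 N) (v N) d l powr max b 0)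
      * (jbr (x2 * N) powr s * modulation_size \<alpha>2 \<beta> (x2 * N) (\<tau>2 N) (v N) d l powr max b 0)"
    proof (rule est[OF d l P])
      fix \<theta> u :: real
      assume \<theta>: "1 \<le> \<theta>" "\<theta> \<le> 4" and u: "0 \<le> u" "u \<le> 2"
      have sum: "x1 * N + x2 * N = (x1 + x2) * N" by (simp add: algebra_simps)
      have A: "lo0 * N powr ?e0 \<le> jbr ((x1 + x2) * N + d * \<theta>) powr s"
      proof -
        have "(if x1 + x2 = 0 then 1 else lo (x1 + x2)) * N powr ?e0 \<le> jbr ((x1 + x2) * N) powr s"
          using N jbr_freq(1)[of "x1 + x2" N] by (auto simp: jbr_def)
        also have "\<dots> \<le> jbr ((x1 + x2) * N + d * \<theta>) powr s * jbr (d * \<theta>) powr \<bar>s\<bar>"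
          using jbr_powr_add_le[of "(x1 + x2) * N + d * \<theta>" "- (d * \<theta>)" s] by (simp add: jbr_minus)
        also have "\<dots> \<le> jbr ((x1 + x2) * N + d * \<theta>) powr s * 5 powr \<bar>s\<bar>"
        proof (intro mult_left_mono powr_mono2 jbr_nonneg)
          show "jbr (d * \<theta>) \<le> 5"
            using d \<theta> mult_mono[of d 1 \<theta> 4] by (simp add: jbr_def abs_mult)
        qed auto
        finally show ?thesis
          by (simp add: lo0_def powr_minus field_simps)
      qed
      have B: "loh * N powr (h * (b - 1))
        \<le> jbr (\<tau>1 N + \<tau>2 N + v N * (d * \<theta>) + l * u - phi \<alpha>0 \<beta> ((x1 + x2) * N + d * \<theta>)) powr (b - 1)" (is "_ \<le> jbr ?M powr _")
      proof -
        have "jbr ?M \<le> modulation_size \<alpha>0 \<beta> ((x1 + x2) * N) (\<tau>1 N + \<tau>2 N) (v N) d l * (jbr \<theta> ^ 3 * jbr u)"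
          using d l by (intro jbr_modulation_le) auto
        also have "\<dots> \<le> (K * N powr h) * (5 ^ 3 * 3)"
          using out[OF N(1)] d l \<theta> u K jbr_nonneg unfolding d_def l_def
          by (intro mult_mono power_mono) (auto simp: jbr_def)
        finally have "jbr ?M \<le> (K * 375) * N powr h" by simp
        moreover have "1 / K * N powr h \<le> jbr ?M"
          using low[OF N(1) \<theta> u] K by (simp add: d_def l_def field_simps)
        ultimately have "loh * (N powr h) powr (b - 1) \<le> jbr ?M powr (b - 1)"
          unfolding loh_def using K N by (intro powr_between) auto
        thus ?thesis by (simp add: powr_powr)
      qed
      have D: "N powr g / K \<le> \<bar>m (x1 * N) (x2 * N) + c * d * \<theta>\<bar>"
        using mult[OF N(1) \<theta>] K by (simp add: d_def field_simps)
      show "P \<le> jbr (x1 * N + x2 * N + d * \<theta>) powr s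
        * jbr (\<tau>1 N + \<tau>2 N + v N * (d * \<theta>) + l * u - phi \<alpha>0 \<beta> (x1 * N + x2 * N + d * \<theta>)) powr (b - 1)
        * \<bar>m (x1 * N) (x2 * N) + c * d * \<theta>\<bar>"
        unfolding P_def sum using K
        by (intro mult_mono A B D) (auto simp: loh_def)
    qed
    also have "\<dots> \<le> C * ((hi x1 * N powr s) * (K * N powr a1) powr max b 0) * ((hi x2 * N powr s) * (K * N powr a2) powr max b 0)"
      using C d l N in1[OF N(1)] in2[OF N(1)] modulation_size_ge_1[of d l] x K
      by (intro mult_mono mult_left_mono powr_mono2 jbr_freq)
         (auto simp: d_def[symmetric] l_def[symmetric] hi0 intro: order_trans[OF zero_le_one])
    also have "\<dots> = C' * N powr (2 * s + (a1 + a2) * max b 0)"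
    proof -
      have "N powr (2 * s + (a1 + a2) * max b 0)
        = N powr s * N powr s * (N powr (a1 * max b 0) * N powr (a2 * max b 0))"
        unfolding powr_add[symmetric] by (simp add: distrib_right)
      moreover have "(K * N powr a) powr max b 0 = K powr max b 0 * N powr (a * max b 0)" for a
        using K N by (simp add: powr_mult powr_powr)
      ultimately show ?thesis by (simp only: C'_def mult_ac)
    qed
    also have "sqrt (d * l) = N powr ((q - p) / 2)"
      using N by (simp add: d_def l_def powr_add[symmetric] powr_half_sqrt[symmetric] powr_powr)
    also have "P = k * N powr (?e0 + h * (b - 1) + g)"
      by (simp add: P_def k_def powr_add)
    finally show ?thesis .
  qed
  \<comment> \<open>The gap between the two exponents: the estimate would bound N^\<epsilon>
    independently of N.\<close>
  define \<epsilon> where "\<epsilon> = (?e0 + h * (b - 1) + g) + (q - p) / 2 - (2 * s + (a1 + a2) * max b 0)"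
  have \<epsilon>: "0 < \<epsilon>" using exponent unfolding \<epsilon>_def by linarith
  then obtain N where N: "N0 \<le> N" "1 \<le> N" "C' / k < N powr \<epsilon>"
    using powr_unbounded by blast
  let ?R = "2 * s + (a1 + a2) * max b 0"
  have "k * N powr \<epsilon> * N powr ?R = k * N powr (?e0 + h * (b - 1) + g) * N powr ((q - p) / 2)"
    by (simp only: \<epsilon>_def mult.assoc powr_add[symmetric]) simp
  also have "\<dots> \<le> C' * N powr ?R" using main N by blast
  finally have "k * N powr \<epsilon> \<le> C'" using N by (simp add: mult_le_cancel_right)
  thus False using N(3) k by (simp add: field_simps)
qed

text \<open>Each hypothesis may bring its own constant, and each lower bound its own threshold; they
  are merged here so that the examples can be assembled from independent pieces.\<close>

lemma not_bilinear_estimate_asymptotic: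
  fixes \<tau>1 \<tau>2 v :: "real \<Rightarrow> real"
  assumes T: "packet_multiplier T m c"
    and x: "x1 \<noteq> 0" "x2 \<noteq> 0" and p: "0 \<le> p"
    and in1: "\<exists>K. \<forall>N\<ge>1. modulation_size \<alpha>1 \<beta> (x1 * N) (\<tau>1 N) (v N) (N powr - p) (N powr q) \<le> K * N powr a1"
    and in2: "\<exists>K. \<forall>N\<ge>1. modulation_size \<alpha>2 \<beta> (x2 * N) (\<tau>2 N) (v N) (N powr - p) (N powr q) \<le> K * N powr a2"
    and out: "\<exists>K. \<forall>N\<ge>1. modulation_size \<alpha>0 \<beta> ((x1 + x2) * N) (\<tau>1 N + \<tau>2 N) (v N) (N powr - p) (N powr q) \<le> K * N powr h"
    and low: "\<exists>K N0. \<forall>N\<ge>N0. \<forall>\<theta>\<in>{1..4}. \<forall>u\<in>{0..2}.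
      N powr h \<le> K * jbr (\<tau>1 N + \<tau>2 N + v N * (N powr - p * \<theta>) + N powr q * u - phi \<alpha>0 \<beta> ((x1 + x2) * N + N powr - p * \<theta>))"
    and mult: "\<exists>K N0. \<forall>N\<ge>N0. \<forall>\<theta>\<in>{1..4}. N powr g \<le> K * \<bar>m (x1 * N) (x2 * N) + c * N powr - p * \<theta>\<bar>"
    and exponent: "2 * s + (a1 + a2) * max b 0 < (q - p) / 2 + (if x1 + x2 = 0 then 0 else s) + g + h * (b - 1)"
  shows "\<not> bilinear_estimate T \<alpha>0 \<alpha>1 \<alpha>2 \<beta> s b"
proof -
  from in1 obtain K1 where K1: "\<And>N. 1 \<le> N \<Longrightarrow> modulation_size \<alpha>1 \<beta> (x1 * N) (\<tau>1 N) (v N) (N powr - p) (N powr q) \<le> K1 * N powr a1" by blast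
  from in2 obtain K2 where K2: "\<And>N. 1 \<le> N \<Longrightarrow> modulation_size \<alpha>2 \<beta> (x2 * N) (\<tau>2 N) (v N) (N powr - p) (N powr q) \<le> K2 * N powr a2" by blast
  from out obtain K3 where K3: "\<And>N. 1 \<le> N \<Longrightarrow> modulation_size \<alpha>0 \<beta> ((x1 + x2) * N) (\<tau>1 N + \<tau>2 N) (v N) (N powr - p) (N powr q) \<le> K3 * N powr h" by blast
  from low obtain K4 N4 where K4: "\<And>N \<theta> u. N4 \<le> N \<Longrightarrow> \<theta> \<in> {1..4} \<Longrightarrow> u \<in> {0..2} \<Longrightarrow>
      N powr h \<le> K4 * jbr (\<tau>1 N + \<tau>2 N + v N * (N powr - p * \<theta>) + N powr q * u - phi \<alpha>0 \<beta> ((x1 + x2) * N + N powr - p * \<theta>))" by blast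
  from mult obtain K5 N5 where K5: "\<And>N \<theta>. N5 \<le> N \<Longrightarrow> \<theta> \<in> {1..4} \<Longrightarrow>
      N powr g \<le> K5 * \<bar>m (x1 * N) (x2 * N) + c * N powr - p * \<theta>\<bar>" by blast
  define K where "K = 1 + \<bar>K1\<bar> + \<bar>K2\<bar> + \<bar>K3\<bar> + \<bar>K4\<bar> + \<bar>K5\<bar>"
  define N0 where "N0 = max 1 (max N4 N5)"
  have le: "y \<le> K * z" if "y \<le> k * z" "0 \<le> z" "k \<le> K" for y z k
    using that mult_right_mono[of k K z] by linarith
  have Ks: "K1 \<le> K" "K2 \<le> K" "K3 \<le> K" "K4 \<le> K" "K5 \<le> K" "0 < K"
    unfolding K_def by linarith+
  show ?thesis
  proof (rule not_bilinear_estimate[OF T x p Ks(6) _ _ _ _ _ exponent])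
    fix N \<theta> u :: real
    assume N: "N0 \<le> N"
    show "modulation_size \<alpha>1 \<beta> (x1 * N) (\<tau>1 N) (v N) (N powr - p) (N powr q) \<le> K * N powr a1"
      by (rule le[OF K1]) (use N Ks in \<open>auto simp: N0_def\<close>)
    show "modulation_size \<alpha>2 \<beta> (x2 * N) (\<tau>2 N) (v N) (N powr - p) (N powr q) \<le> K * N powr a2"
      by (rule le[OF K2]) (use N Ks in \<open>auto simp: N0_def\<close>)
    show "modulation_size \<alpha>0 \<beta> ((x1 + x2) * N) (\<tau>1 N + \<tau>2 N) (v N) (N powr - p) (N powr q) \<le> K * N powr h"
      by (rule le[OF K3]) (use N Ks in \<open>auto simp: N0_def\<close>)
    assume \<theta>: "1 \<le> \<theta>" "\<theta> \<le> 4"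
    show "N powr g \<le> K * \<bar>m (x1 * N) (x2 * N) + c * N powr - p * \<theta>\<bar>"
      by (rule le[OF K5]) (use N Ks \<theta> in \<open>auto simp: N0_def\<close>)
    assume "0 \<le> u" "u \<le> 2"
    thus "N powr h \<le> K * jbr (\<tau>1 N + \<tau>2 N + v N * (N powr - p * \<theta>) + N powr q * u - phi \<alpha>0 \<beta> ((x1 + x2) * N + N powr - p * \<theta>))"
      by (intro le[OF K4]) (use N Ks \<theta> jbr_nonneg in \<open>auto simp: N0_def\<close>)
  qed
qed

section \<open>Multipliers and modulations along the families of packets\<close>

text \<open>Across the packet the multiplier moves by at most 4, which is at most half of |\<mu>| N
  once |\<mu>| N >= 8.\<close>

lemma multiplier_lower:
  assumes T: "packet_multiplier T m c" and p: "0 \<le> p"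
    and m: "\<And>N. m (x1 * N) (x2 * N) = \<mu> * N" and \<mu>: "\<mu> \<noteq> 0"
  shows "\<exists>K N0. \<forall>N\<ge>N0. \<forall>\<theta>\<in>{1..4}. N powr 1 \<le> K * \<bar>m (x1 * N) (x2 * N) + c * N powr - p * \<theta>\<bar>"
proof (rule exI[of _ "2 / \<bar>\<mu>\<bar>"], rule exI[of _ "max 1 (8 / \<bar>\<mu>\<bar>)"], intro allI impI ballI)
  fix N \<theta> :: real
  assume N: "max 1 (8 / \<bar>\<mu>\<bar>) \<le> N" and \<theta>: "\<theta> \<in> {1..4}"
  have c: "0 \<le> c" "c \<le> 1" using T by (auto simp: packet_multiplier_def)
  have d: "0 < N powr - p" "N powr - p \<le> 1" using N p powr_mono[of "- p" 0 N] by auto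
  have "c * N powr - p \<le> 1" using c d by (simp add: mult_le_one)
  hence "c * N powr - p * \<theta> \<le> 1 * 4" using c d \<theta> by (intro mult_mono) auto
  moreover have "0 \<le> c * N powr - p * \<theta>" using c d \<theta> by auto
  moreover have "8 \<le> \<bar>\<mu>\<bar> * N" using N \<mu> by (simp add: field_simps)
  moreover have "\<bar>\<mu> * N\<bar> = \<bar>\<mu>\<bar> * N" using N by (simp add: abs_mult)
  ultimately have "\<bar>\<mu>\<bar> * N / 2 \<le> \<bar>\<mu> * N + c * N powr - p * \<theta>\<bar>" by linarith
  thus "N powr 1 \<le> 2 / \<bar>\<mu>\<bar> * \<bar>m (x1 * N) (x2 * N) + c * N powr - p * \<theta>\<bar>"
    unfolding m using \<mu> N by (simp add: field_simps)
qed

lemma powr_neg_bounds: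
  fixes N p :: real
  assumes "1 \<le> N" "0 \<le> p"
  shows "0 < N powr - p" "N powr - p \<le> 1"
  using assms powr_mono[of "- p" 0 N] by auto

text \<open>At width N^(-1/2) the curvature term N d^2 is bounded. What remains is the distance of
  the centre from the curve and the slope mismatch, which is estimated here without using the
  smallness of d.\<close>

lemma modulation_size_parabolic:
  fixes \<tau> v :: "real \<Rightarrow> real"
  assumes h: "0 \<le> h"
    and \<tau>: "\<And>N. 1 \<le> N \<Longrightarrow> \<bar>\<tau> N - phi \<alpha> \<beta> (x * N)\<bar> \<le> A * N powr h"
    and v: "\<And>N. 1 \<le> N \<Longrightarrow> \<bar>v N - (3 * \<alpha> * (x * N)\<^sup>2 - \<beta>)\<bar> \<le> B * N powr h"
  shows "\<exists>K. \<forall>N\<ge>1. modulation_size \<alpha> \<beta> (x * N) (\<tau> N) (v N) (N powr - (1 / 2)) (N powr 0) \<le> K * N powr h"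
proof (intro exI allI impI)
  fix N :: real
  assume N: "1 \<le> N"
  define d where "d = N powr - (1 / 2)"
  have d: "0 < d" "d \<le> 1" using powr_neg_bounds[OF N, of "1 / 2"] by (auto simp: d_def)
  have d2: "d\<^sup>2 = 1 / N" using N by (simp add: d_def powr_power powr_minus field_simps)
  have M: "1 \<le> N powr h" using N h by (simp add: ge_one_powr_ge_zero)
  have "\<bar>v N - (3 * \<alpha> * (x * N)\<^sup>2 - \<beta>)\<bar> * d \<le> B * N powr h * 1"
    using d v[OF N] by (intro mult_mono) auto
  moreover have "3 * \<bar>\<alpha> * (x * N)\<bar> * d\<^sup>2 = 3 * \<bar>\<alpha> * x\<bar> * 1"
    using N by (simp add: d2 abs_mult)
  moreover have "\<bar>\<alpha>\<bar> * d ^ 3 \<le> \<bar>\<alpha>\<bar> * 1"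
    using d by (intro mult_left_mono) (auto simp: power_le_one)
  moreover have "3 * \<bar>\<alpha> * x\<bar> * 1 \<le> 3 * \<bar>\<alpha> * x\<bar> * N powr h" "\<bar>\<alpha>\<bar> * 1 \<le> \<bar>\<alpha>\<bar> * N powr h"
    using M by (intro mult_left_mono; simp)+
  ultimately show "modulation_size \<alpha> \<beta> (x * N) (\<tau> N) (v N) (N powr - (1 / 2)) (N powr 0)
      \<le> (2 + A + B + 3 * \<bar>\<alpha> * x\<bar> + \<bar>\<alpha>\<bar>) * N powr h"
    unfolding modulation_size_def d_def[symmetric] distrib_right
    using \<tau>[OF N] M N by simp
qed

text \<open>At width N^-2 even the full slope of the curve, of size N^2, varies \<tau> only by a
  bounded amount, so v = 0 serves every symbol and only the position of the centre matters.\<close>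

lemma modulation_size_point:
  fixes \<tau> :: "real \<Rightarrow> real"
  assumes h: "0 \<le> h"
    and \<tau>: "\<And>N. 1 \<le> N \<Longrightarrow> \<bar>\<tau> N - phi \<alpha> \<beta> (x * N)\<bar> \<le> A * N powr h"
  shows "\<exists>K. \<forall>N\<ge>1. modulation_size \<alpha> \<beta> (x * N) (\<tau> N) 0 (N powr - 2) (N powr 0) \<le> K * N powr h"
proof (intro exI allI impI)
  fix N :: real
  assume N: "1 \<le> N"
  define d where "d = N powr - 2"
  have d: "0 < d" "d \<le> 1" using powr_neg_bounds[OF N, of 2] by (auto simp: d_def)
  have d2: "N\<^sup>2 * d = 1" using N by (simp add: d_def powr_minus field_simps)
  have M: "1 \<le> N powr h" using N h by (simp add: ge_one_powr_ge_zero)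
  have "\<bar>0 - (3 * \<alpha> * (x * N)\<^sup>2 - \<beta>)\<bar> * d \<le> (3 * \<bar>\<alpha>\<bar> * x\<^sup>2 * N\<^sup>2 + \<bar>\<beta>\<bar>) * d"
    using d by (intro mult_right_mono) (auto simp: abs_mult power_mult_distrib intro: order_trans[OF abs_triangle_ineq4])
  also have "\<dots> = 3 * \<bar>\<alpha>\<bar> * x\<^sup>2 * (N\<^sup>2 * d) + \<bar>\<beta>\<bar> * d" by (simp add: algebra_simps)
  also have "\<dots> \<le> (3 * \<bar>\<alpha>\<bar> * x\<^sup>2 + \<bar>\<beta>\<bar>) * 1"
    unfolding d2 using d by (simp add: mult_left_le)
  finally have "\<bar>0 - (3 * \<alpha> * (x * N)\<^sup>2 - \<beta>)\<bar> * d \<le> (3 * \<bar>\<alpha>\<bar> * x\<^sup>2 + \<bar>\<beta>\<bar>) * 1" .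
  moreover have "3 * \<bar>\<alpha> * (x * N)\<bar> * d\<^sup>2 \<le> 3 * \<bar>\<alpha> * x\<bar> * 1"
  proof -
    have "N * d\<^sup>2 = 1 / N * (N\<^sup>2 * d) * d" using N by (simp add: power2_eq_square)
    also have "\<dots> \<le> 1" unfolding d2 using N d by (simp add: divide_le_eq)
    finally have "N * d\<^sup>2 \<le> 1" .
    have "3 * \<bar>\<alpha> * (x * N)\<bar> * d\<^sup>2 = 3 * \<bar>\<alpha> * x\<bar> * (N * d\<^sup>2)" using N by (simp add: abs_mult)
    also have "\<dots> \<le> 3 * \<bar>\<alpha> * x\<bar> * 1" using \<open>N * d\<^sup>2 \<le> 1\<close> by (intro mult_left_mono) auto
    finally show ?thesis .
  qed
  moreover have "\<bar>\<alpha>\<bar> * d ^ 3 \<le> \<bar>\<alpha>\<bar> * 1"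
    using d by (intro mult_left_mono) (auto simp: power_le_one)
  moreover have "(3 * \<bar>\<alpha>\<bar> * x\<^sup>2 + \<bar>\<beta>\<bar>) * 1 \<le> (3 * \<bar>\<alpha>\<bar> * x\<^sup>2 + \<bar>\<beta>\<bar>) * N powr h"
    "3 * \<bar>\<alpha> * x\<bar> * 1 \<le> 3 * \<bar>\<alpha> * x\<bar> * N powr h" "\<bar>\<alpha>\<bar> * 1 \<le> \<bar>\<alpha>\<bar> * N powr h"
    using M by (intro mult_left_mono; simp)+
  ultimately show "modulation_size \<alpha> \<beta> (x * N) (\<tau> N) 0 (N powr - 2) (N powr 0)
      \<le> (2 + A + (3 * \<bar>\<alpha>\<bar> * x\<^sup>2 + \<bar>\<beta>\<bar>) + 3 * \<bar>\<alpha> * x\<bar> + \<bar>\<alpha>\<bar>) * N powr h"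
    unfolding modulation_size_def d_def[symmetric]
    using \<tau>[OF N] M N by (simp add: distrib_right)
qed

text \<open>The modulation is \<kappa> N^3 plus that of the same packet recentred on the curve. The
  latter is O(N^2) over the whole packet, so the cubic term wins for large N.\<close>

lemma modulation_lower:
  fixes \<tau> v :: "real \<Rightarrow> real"
  assumes p: "0 \<le> p" and \<kappa>: "\<kappa> \<noteq> 0"
    and size: "\<exists>K. \<forall>N\<ge>1. modulation_size \<alpha> \<beta> (x * N) (phi \<alpha> \<beta> (x * N)) (v N) (N powr - p) (N powr q) \<le> K * N powr 2"
    and \<tau>: "\<And>N. \<tau> N - phi \<alpha> \<beta> (x * N) = \<kappa> * N ^ 3"
  shows "\<exists>K N0. \<forall>N\<ge>N0. \<forall>\<theta>\<in>{1..4}. \<forall>u\<in>{0..2}.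
    N powr 3 \<le> K * jbr (\<tau> N + v N * (N powr - p * \<theta>) + N powr q * u - phi \<alpha> \<beta> (x * N + N powr - p * \<theta>))"
proof -
  obtain K where K: "\<And>N. 1 \<le> N \<Longrightarrow> modulation_size \<alpha> \<beta> (x * N) (phi \<alpha> \<beta> (x * N)) (v N) (N powr - p) (N powr q) \<le> K * N powr 2"
    using size by blast
  show ?thesis
  \<comment> \<open>The remainder is at most 375 K N^2, with 375 = 5^3 * 3; beyond the threshold
    this is at most half of |\<kappa>| N^3.\<close>
  proof (rule exI[of _ "2 / \<bar>\<kappa>\<bar>"], rule exI[of _ "max 1 (750 * K / \<bar>\<kappa>\<bar>)"], intro allI impI ballI)
    fix N \<theta> u :: real
    assume N: "max 1 (750 * K / \<bar>\<kappa>\<bar>) \<le> N" and \<theta>: "\<theta> \<in> {1..4}" and u: "u \<in> {0..2}"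
    define d l where "d = N powr - p" and "l = N powr q"
    have d: "0 < d" and l: "0 < l" using N by (auto simp: d_def l_def)
    define m0 where "m0 = phi \<alpha> \<beta> (x * N) + v N * (d * \<theta>) + l * u - phi \<alpha> \<beta> (x * N + d * \<theta>)"
    have nonneg: "0 \<le> K * N powr 2"
      using K[of N] N d l modulation_size_ge_1[of d l \<alpha> \<beta> "x * N" "phi \<alpha> \<beta> (x * N)" "v N"]
      unfolding d_def l_def by linarith
    have "jbr m0 \<le> modulation_size \<alpha> \<beta> (x * N) (phi \<alpha> \<beta> (x * N)) (v N) d l * (jbr \<theta> ^ 3 * jbr u)"
      unfolding m0_def using d l by (intro jbr_modulation_le) auto
    also have "\<dots> \<le> (K * N powr 2) * (5 ^ 3 * 3)"
      using nonneg K[of N] N d l \<theta> u modulation_size_ge_1[of d l] jbr_nonneg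
      by (intro mult_mono power_mono) (auto simp: jbr_def d_def l_def intro: order_trans[OF zero_le_one])
    finally have "\<bar>m0\<bar> \<le> 375 * K * N\<^sup>2" using N by (simp add: jbr_def)
    also have "\<dots> \<le> \<bar>\<kappa>\<bar> * N ^ 3 / 2"
    proof -
      have "750 * K \<le> \<bar>\<kappa>\<bar> * N" using N \<kappa> by (simp add: field_simps)
      hence "750 * K * N\<^sup>2 \<le> \<bar>\<kappa>\<bar> * N * N\<^sup>2" by (intro mult_right_mono) auto
      thus ?thesis by (simp add: power2_eq_square power3_eq_cube)
    qed
    finally have "\<bar>m0\<bar> \<le> \<bar>\<kappa>\<bar> * N ^ 3 / 2" .
    moreover have "\<bar>\<kappa> * N ^ 3\<bar> = \<bar>\<kappa>\<bar> * N ^ 3" using N by (simp add: abs_mult)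
    ultimately have "\<bar>\<kappa>\<bar> * N ^ 3 / 2 \<le> jbr (\<kappa> * N ^ 3 + m0)" unfolding jbr_def by linarith
    also have "\<kappa> * N ^ 3 + m0 = \<tau> N + v N * (d * \<theta>) + l * u - phi \<alpha> \<beta> (x * N + d * \<theta>)"
      using \<tau>[of N] by (simp add: m0_def)
    finally show "N powr 3 \<le> 2 / \<bar>\<kappa>\<bar> * jbr (\<tau> N + v N * (N powr - p * \<theta>) + N powr q * u - phi \<alpha> \<beta> (x * N + N powr - p * \<theta>))"
      using \<kappa> N by (simp add: d_def l_def field_simps)
  qed
qed

lemma modulation_trivial_lower:
  fixes f :: "real \<Rightarrow> real \<Rightarrow> real \<Rightarrow> real"
  shows "\<exists>K N0. \<forall>N\<ge>N0. \<forall>\<theta>\<in>{1..4}. \<forall>u\<in>{0..2}. N powr 0 \<le> K * jbr (f N \<theta> u)"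
  using jbr_ge_1 by (intro exI[of _ 1] exI[of _ 1]) auto

section \<open>Counterexamples\<close>

lemma phi_scale: "phi \<alpha> \<beta> (x * N) = \<alpha> * x ^ 3 * N ^ 3 - \<beta> * x * N"
  by (simp add: phi_def power_mult_distrib)

text \<open>The terms with \<beta> cancel because frequencies add, so only the cubic coefficients
  have to match.\<close>

lemma phi_resonance:
  assumes "\<alpha>0 * (x1 + x2) ^ 3 = \<alpha>1 * x1 ^ 3 + \<alpha>2 * x2 ^ 3"
  shows "phi \<alpha>1 \<beta> (x1 * N) + phi \<alpha>2 \<beta> (x2 * N) = phi \<alpha>0 \<beta> ((x1 + x2) * N)"
  unfolding phi_scale assms by (simp add: algebra_simps)

text \<open>For b <= 0 input modulations cost nothing in the upper bound, so two packets at
  frequency N may be placed freely: their sum is put on the output curve at 2N, with its slope. The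
  count is 2s < -1/4 + s + 1.\<close>

lemma not_estimate_nonpos_b:
  assumes T: "packet_multiplier T m c" and m: "\<And>N. m (1 * N) (1 * N) = \<mu> * N" "\<mu> \<noteq> 0"
    and "b \<le> 0" "s < 3 / 4"
  shows "\<not> bilinear_estimate T \<alpha>0 \<alpha>1 \<alpha>2 \<beta> s b"
proof -
  let ?\<tau> = "\<lambda>N. phi \<alpha>0 \<beta> ((1 + 1) * N) / 2" and ?v = "\<lambda>N. 3 * \<alpha>0 * ((1 + 1) * N)\<^sup>2 - \<beta>"
  have inp: "\<exists>K. \<forall>N\<ge>1. modulation_size \<alpha> \<beta> (1 * N) (?\<tau> N) (?v N) (N powr - (1 / 2)) (N powr 0) \<le> K * N powr 3" for \<alpha>
  proof (rule modulation_size_parabolic)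
    fix N :: real
    assume N: "1 \<le> N"
    have "?\<tau> N - phi \<alpha> \<beta> (1 * N) = (4 * \<alpha>0 - \<alpha>) * N ^ 3"
      by (simp add: phi_def field_simps)
    thus "\<bar>?\<tau> N - phi \<alpha> \<beta> (1 * N)\<bar> \<le> \<bar>4 * \<alpha>0 - \<alpha>\<bar> * N powr 3"
      using N by (simp add: abs_mult)
    have "?v N - (3 * \<alpha> * (1 * N)\<^sup>2 - \<beta>) = 3 * (4 * \<alpha>0 - \<alpha>) * N\<^sup>2"
      by (simp add: field_simps)
    moreover have "N\<^sup>2 \<le> N ^ 3" using N by (intro power_increasing) auto
    ultimately show "\<bar>?v N - (3 * \<alpha> * (1 * N)\<^sup>2 - \<beta>)\<bar> \<le> \<bar>3 * (4 * \<alpha>0 - \<alpha>)\<bar> * N powr 3"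
      using N by (simp only: abs_mult) (simp add: mult_left_mono)
  qed simp
  have out: "\<exists>K. \<forall>N\<ge>1. modulation_size \<alpha>0 \<beta> ((1 + 1) * N) (?\<tau> N + ?\<tau> N) (?v N) (N powr - (1 / 2)) (N powr 0) \<le> K * N powr 0"
    by (rule modulation_size_parabolic[where A = 0 and B = 0]) auto
  show ?thesis
    by (rule not_bilinear_estimate_asymptotic[OF T _ _ _ inp inp out modulation_trivial_lower multiplier_lower[OF T _ m]])
       (use assms in auto)
qed

text \<open>Opposite frequencies share their slope. With d = 1 the curvature already gives
  modulation N, so l = N is free. The product has frequency about 1 and slope of size N^2, hence
  modulation N^2. In 2s + 2b < 1/2 + 2(b - 1) the b cancels.\<close>

lemma not_estimate_low_output:
  assumes "\<alpha>1 \<noteq> 0" "0 \<le> b" "s < - 3 / 4"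
  shows "\<not> bilinear_estimate (\<lambda>w1 w2. pdx (\<lambda>z. w1 z * w2 z)) \<alpha>0 \<alpha>1 \<alpha>1 \<beta> s b"
proof -
  let ?v = "\<lambda>N. 3 * \<alpha>1 * (1 * N)\<^sup>2 - \<beta>"
  have inp: "\<exists>K. \<forall>N\<ge>1. modulation_size \<alpha>1 \<beta> (x * N) (phi \<alpha>1 \<beta> (x * N)) (?v N) (N powr - 0) (N powr 1) \<le> K * N powr 1"
    if "x\<^sup>2 = 1" for x
  proof (intro exI allI impI)
    fix N :: real
    assume N: "1 \<le> N"
    have "\<bar>\<alpha>1\<bar> \<le> N * \<bar>\<alpha>1\<bar>" using N by (simp add: mult_le_cancel_right1)
    moreover have "\<bar>\<alpha>1 * (x * N)\<bar> = N * \<bar>\<alpha>1\<bar>" using N that by (auto simp: abs_mult power2_eq_1_iff)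
    ultimately show "modulation_size \<alpha>1 \<beta> (x * N) (phi \<alpha>1 \<beta> (x * N)) (?v N) (N powr - 0) (N powr 1) \<le> (2 + 4 * \<bar>\<alpha>1\<bar>) * N powr 1"
      using N that by (simp add: modulation_size_def power_mult_distrib distrib_right)
  qed
  have out: "\<exists>K. \<forall>N\<ge>1. modulation_size \<alpha>0 \<beta> ((1 + - 1) * N) (phi \<alpha>1 \<beta> (1 * N) + phi \<alpha>1 \<beta> (- 1 * N)) (?v N) (N powr - 0) (N powr 1) \<le> K * N powr 2"
  proof (intro exI allI impI)
    fix N :: real
    assume N: "1 \<le> N"
    have "N \<le> N\<^sup>2" "1 \<le> N\<^sup>2" using N by (simp_all add: self_le_power)
    moreover have "\<bar>\<alpha>0\<bar> * 1 \<le> \<bar>\<alpha>0\<bar> * N\<^sup>2" using \<open>1 \<le> N\<^sup>2\<close> by (intro mult_left_mono) auto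
    ultimately show "modulation_size \<alpha>0 \<beta> ((1 + - 1) * N) (phi \<alpha>1 \<beta> (1 * N) + phi \<alpha>1 \<beta> (- 1 * N)) (?v N) (N powr - 0) (N powr 1)
      \<le> (2 + 3 * \<bar>\<alpha>1\<bar> + \<bar>\<alpha>0\<bar>) * N powr 2"
      using N by (simp add: modulation_size_def phi_def abs_mult distrib_right)
  qed
  have low: "\<exists>K N0. \<forall>N\<ge>N0. \<forall>\<theta>\<in>{1..4}. \<forall>u\<in>{0..2}. N powr 2 \<le> K * jbr (phi \<alpha>1 \<beta> (1 * N) + phi \<alpha>1 \<beta> (- 1 * N)
      + ?v N * (N powr - 0 * \<theta>) + N powr 1 * u - phi \<alpha>0 \<beta> ((1 + - 1) * N + N powr - 0 * \<theta>))"
  \<comment> \<open>Beyond the threshold the main term 3 |\<alpha>1| N^2 \<theta> exceeds N u <= 2N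
    and |\<alpha>0| \<theta>^3 <= 64 |\<alpha>0| with |\<alpha>1| N^2 to spare.\<close>
  proof (rule exI[of _ "1 / (2 * \<bar>\<alpha>1\<bar>)"], rule exI[of _ "max 1 ((2 + 64 * \<bar>\<alpha>0\<bar>) / \<bar>\<alpha>1\<bar>)"], intro allI impI ballI)
    fix N \<theta> u :: real
    assume N: "max 1 ((2 + 64 * \<bar>\<alpha>0\<bar>) / \<bar>\<alpha>1\<bar>) \<le> N" and \<theta>: "\<theta> \<in> {1..4}" and u: "u \<in> {0..2}"
    let ?M = "phi \<alpha>1 \<beta> (1 * N) + phi \<alpha>1 \<beta> (- 1 * N)
      + ?v N * (N powr - 0 * \<theta>) + N powr 1 * u - phi \<alpha>0 \<beta> ((1 + - 1) * N + N powr - 0 * \<theta>)"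
    have M: "?M = 3 * \<alpha>1 * N\<^sup>2 * \<theta> + N * u - \<alpha>0 * \<theta> ^ 3"
      using N by (simp add: phi_def algebra_simps)
    have "3 * \<bar>\<alpha>1\<bar> * N\<^sup>2 * 1 \<le> 3 * \<bar>\<alpha>1\<bar> * N\<^sup>2 * \<theta>" using \<theta> by (intro mult_left_mono) auto
    moreover have "\<bar>3 * \<alpha>1 * N\<^sup>2 * \<theta>\<bar> = 3 * \<bar>\<alpha>1\<bar> * N\<^sup>2 * \<theta>" using \<theta> by (simp add: abs_mult)
    moreover have "0 \<le> N * u" "N * u \<le> N * 2" using N u by (auto intro!: mult_left_mono)
    moreover have "\<bar>\<alpha>0 * \<theta> ^ 3\<bar> \<le> \<bar>\<alpha>0\<bar> * 64 * N"
    proof -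
      have "\<theta> ^ 3 \<le> 4 ^ 3" using \<theta> by (intro power_mono) auto
      hence "\<bar>\<alpha>0\<bar> * \<theta> ^ 3 \<le> \<bar>\<alpha>0\<bar> * 64" by (intro mult_left_mono) auto
      also have "\<dots> \<le> \<bar>\<alpha>0\<bar> * 64 * N" using N by (simp add: mult_le_cancel_left1)
      finally show ?thesis using \<theta> by (simp add: abs_mult)
    qed
    moreover have "2 * N + \<bar>\<alpha>0\<bar> * 64 * N \<le> \<bar>\<alpha>1\<bar> * N\<^sup>2"
    proof -
      have "2 + 64 * \<bar>\<alpha>0\<bar> \<le> \<bar>\<alpha>1\<bar> * N" using N assms by (simp add: field_simps)
      hence "(2 + 64 * \<bar>\<alpha>0\<bar>) * N \<le> \<bar>\<alpha>1\<bar> * N * N" using N by (intro mult_right_mono) auto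
      thus ?thesis by (simp add: power2_eq_square algebra_simps)
    qed
    ultimately have "2 * \<bar>\<alpha>1\<bar> * N\<^sup>2 \<le> \<bar>?M\<bar>" unfolding M by linarith
    hence "2 * \<bar>\<alpha>1\<bar> * N\<^sup>2 \<le> jbr ?M" unfolding jbr_def by linarith
    thus "N powr 2 \<le> 1 / (2 * \<bar>\<alpha>1\<bar>) * jbr ?M" using N assms by (simp add: field_simps)
  qed
  have mult: "\<exists>K N0. \<forall>N\<ge>N0 :: real. \<forall>\<theta>\<in>{1..4 :: real}. N powr 0 \<le> K * \<bar>1 * N + - 1 * N + 1 * N powr - 0 * \<theta>\<bar>"
    by (intro exI[of _ 1]) auto
  show ?thesis
    by (rule not_bilinear_estimate_asymptotic[OF packet_multiplier_divergence _ _ _ inp inp out low mult])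
       (use assms in \<open>auto simp: field_simps\<close>)
qed

text \<open>All three packets lie on their curves with one common slope, so every modulation is
  bounded at width N^(-1/2): 2s < -1/4 + s + 1.\<close>

lemma not_estimate_parabolic_resonance:
  assumes T: "packet_multiplier T m c" and m: "\<And>N. m (x1 * N) (x2 * N) = \<mu> * N" "\<mu> \<noteq> 0"
    and x: "x1 \<noteq> 0" "x2 \<noteq> 0" "x1 + x2 \<noteq> 0"
    and resonance: "\<alpha>0 * (x1 + x2) ^ 3 = \<alpha>1 * x1 ^ 3 + \<alpha>2 * x2 ^ 3"
    and velocity: "\<alpha>1 * x1\<^sup>2 = \<alpha>0 * (x1 + x2)\<^sup>2" "\<alpha>2 * x2\<^sup>2 = \<alpha>0 * (x1 + x2)\<^sup>2"
    and "s < 3 / 4"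
  shows "\<not> bilinear_estimate T \<alpha>0 \<alpha>1 \<alpha>2 \<beta> s b"
proof -
  let ?\<tau>1 = "\<lambda>N. phi \<alpha>1 \<beta> (x1 * N)" and ?\<tau>2 = "\<lambda>N. phi \<alpha>2 \<beta> (x2 * N)"
    and ?v = "\<lambda>N. 3 * \<alpha>0 * ((x1 + x2) * N)\<^sup>2 - \<beta>"
  have v: "?v N = 3 * \<alpha>1 * (x1 * N)\<^sup>2 - \<beta>" "?v N = 3 * \<alpha>2 * (x2 * N)\<^sup>2 - \<beta>" for N
    using velocity by (simp_all add: power_mult_distrib)
  have in1: "\<exists>K. \<forall>N\<ge>1. modulation_size \<alpha>1 \<beta> (x1 * N) (?\<tau>1 N) (?v N) (N powr - (1 / 2)) (N powr 0) \<le> K * N powr 0"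
    by (rule modulation_size_parabolic[where A = 0 and B = 0]) (simp_all add: v(1))
  have in2: "\<exists>K. \<forall>N\<ge>1. modulation_size \<alpha>2 \<beta> (x2 * N) (?\<tau>2 N) (?v N) (N powr - (1 / 2)) (N powr 0) \<le> K * N powr 0"
    by (rule modulation_size_parabolic[where A = 0 and B = 0]) (simp_all add: v(2))
  have "?\<tau>1 N + ?\<tau>2 N = phi \<alpha>0 \<beta> ((x1 + x2) * N)" for N
    using resonance by (rule phi_resonance)
  hence out: "\<exists>K. \<forall>N\<ge>1. modulation_size \<alpha>0 \<beta> ((x1 + x2) * N) (?\<tau>1 N + ?\<tau>2 N) (?v N) (N powr - (1 / 2)) (N powr 0) \<le> K * N powr 0"
    by (intro modulation_size_parabolic[where A = 0 and B = 0]) auto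
  show ?thesis
    by (rule not_bilinear_estimate_asymptotic[OF T x(1,2) _ in1 in2 out modulation_trivial_lower multiplier_lower[OF T _ m]])
       (use assms in auto)
qed

text \<open>On its curve a packet of width N^-2 has bounded modulation whatever its slope. The loss
  -1 from sqrt(d l) cancels the gain 1 of the derivative, leaving 2s < s, or 2s < 0 at total
  frequency zero.\<close>

lemma not_estimate_resonance:
  assumes T: "packet_multiplier T m c" and m: "\<And>N. m (x1 * N) (x2 * N) = \<mu> * N" "\<mu> \<noteq> 0"
    and x: "x1 \<noteq> 0" "x2 \<noteq> 0"
    and resonance: "\<alpha>0 * (x1 + x2) ^ 3 = \<alpha>1 * x1 ^ 3 + \<alpha>2 * x2 ^ 3"
    and "s < 0"
  shows "\<not> bilinear_estimate T \<alpha>0 \<alpha>1 \<alpha>2 \<beta> s b"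
proof -
  let ?\<tau>1 = "\<lambda>N. phi \<alpha>1 \<beta> (x1 * N)" and ?\<tau>2 = "\<lambda>N. phi \<alpha>2 \<beta> (x2 * N)"
  have inp: "\<exists>K. \<forall>N\<ge>1. modulation_size \<alpha> \<beta> (x * N) (phi \<alpha> \<beta> (x * N)) 0 (N powr - 2) (N powr 0) \<le> K * N powr 0" for \<alpha> x
    by (rule modulation_size_point[where A = 0]) auto
  have "?\<tau>1 N + ?\<tau>2 N = phi \<alpha>0 \<beta> ((x1 + x2) * N)" for N
    using resonance by (rule phi_resonance)
  hence out: "\<exists>K. \<forall>N\<ge>1. modulation_size \<alpha>0 \<beta> ((x1 + x2) * N) (?\<tau>1 N + ?\<tau>2 N) 0 (N powr - 2) (N powr 0) \<le> K * N powr 0"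
    by (intro modulation_size_point[where A = 0]) auto
  show ?thesis
    by (rule not_bilinear_estimate_asymptotic[OF T x _ inp inp out modulation_trivial_lower multiplier_lower[OF T _ m]])
       (use assms in auto)
qed

text \<open>Input and output for \<alpha>1 sit at -N and N, where the slopes coincide; the other
  input at 2N goes wherever puts the product on the output curve, at the price of modulation N^3.
  The count is 2s + 3 max(b,0) < -1/4 + s + 1.\<close>

lemma not_estimate_modulated_input:
  assumes T: "packet_multiplier T m c" and m: "\<And>N. m (- 1 * N) (2 * N) = \<mu> * N" "\<mu> \<noteq> 0"
    and exponent: "s + 3 * max b 0 < 3 / 4"
  shows "\<not> bilinear_estimate T \<alpha>1 \<alpha>1 \<alpha>2 \<beta> s b"
proof -
  let ?\<tau>1 = "\<lambda>N. phi \<alpha>1 \<beta> (- 1 * N)" and ?\<tau>2 = "\<lambda>N. phi \<alpha>1 \<beta> ((- 1 + 2) * N) - phi \<alpha>1 \<beta> (- 1 * N)"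
    and ?v = "\<lambda>N. 3 * \<alpha>1 * N\<^sup>2 - \<beta>"
  have in1: "\<exists>K. \<forall>N\<ge>1. modulation_size \<alpha>1 \<beta> (- 1 * N) (?\<tau>1 N) (?v N) (N powr - (1 / 2)) (N powr 0) \<le> K * N powr 0"
    by (rule modulation_size_parabolic[where A = 0 and B = 0]) auto
  have in2: "\<exists>K. \<forall>N\<ge>1. modulation_size \<alpha>2 \<beta> (2 * N) (?\<tau>2 N) (?v N) (N powr - (1 / 2)) (N powr 0) \<le> K * N powr 3"
  proof (rule modulation_size_parabolic)
    fix N :: real
    assume N: "1 \<le> N"
    have "?\<tau>2 N - phi \<alpha>2 \<beta> (2 * N) = (2 * \<alpha>1 - 8 * \<alpha>2) * N ^ 3"
      by (simp add: phi_def algebra_simps)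
    thus "\<bar>?\<tau>2 N - phi \<alpha>2 \<beta> (2 * N)\<bar> \<le> \<bar>2 * \<alpha>1 - 8 * \<alpha>2\<bar> * N powr 3"
      using N by (simp add: abs_mult)
    have "?v N - (3 * \<alpha>2 * (2 * N)\<^sup>2 - \<beta>) = (3 * \<alpha>1 - 12 * \<alpha>2) * N\<^sup>2"
      by (simp add: algebra_simps)
    moreover have "N\<^sup>2 \<le> N ^ 3" using N by (intro power_increasing) auto
    ultimately show "\<bar>?v N - (3 * \<alpha>2 * (2 * N)\<^sup>2 - \<beta>)\<bar> \<le> \<bar>3 * \<alpha>1 - 12 * \<alpha>2\<bar> * N powr 3"
      using N by (simp only: abs_mult) (simp add: mult_left_mono)
  qed simp
  have out: "\<exists>K. \<forall>N\<ge>1. modulation_size \<alpha>1 \<beta> ((- 1 + 2) * N) (?\<tau>1 N + ?\<tau>2 N) (?v N) (N powr - (1 / 2)) (N powr 0) \<le> K * N powr 0"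
    by (rule modulation_size_parabolic[where A = 0 and B = 0]) auto
  show ?thesis
    by (rule not_bilinear_estimate_asymptotic[OF T _ _ _ in1 in2 out modulation_trivial_lower multiplier_lower[OF T _ m]])
       (use exponent in auto)
qed

text \<open>The condition on y equates the slopes of the two inputs, both on their curves; the
  product then misses the output curve by about N^3. The count is 2s < -1/4 + s + 1 + 3(b -
  1).\<close>

lemma not_estimate_parabolic_modulated_output:
  assumes T: "packet_multiplier T m c" and m: "\<And>N. m (1 * N) (y * N) = \<mu> * N" "\<mu> \<noteq> 0"
    and "\<alpha>1 \<noteq> 0" and y: "0 < y" "\<alpha>2 * y\<^sup>2 = \<alpha>1"
    and exponent: "s < 3 * b - 9 / 4"
  shows "\<not> bilinear_estimate T \<alpha>1 \<alpha>1 \<alpha>2 \<beta> s b"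
proof -
  let ?\<tau>1 = "\<lambda>N. phi \<alpha>1 \<beta> (1 * N)" and ?\<tau>2 = "\<lambda>N. phi \<alpha>2 \<beta> (y * N)" and ?v = "\<lambda>N. 3 * \<alpha>1 * N\<^sup>2 - \<beta>"
  \<comment> \<open>The resonance function at (1, y), using \<alpha>2 y^3 = \<alpha>1 y; it is
    nonzero as 1 + y > 1.\<close>
  define \<kappa> where "\<kappa> = \<alpha>1 * ((1 + y) - (1 + y) ^ 3)"
  have "(1 + y) ^ 1 < (1 + y) ^ 3" using y by (intro power_strict_increasing) auto
  hence \<kappa>: "\<kappa> \<noteq> 0" using assms by (simp add: \<kappa>_def)
  have v: "?v N = 3 * \<alpha>2 * (y * N)\<^sup>2 - \<beta>" for N
    using y by (simp add: power_mult_distrib)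
  have \<tau>: "?\<tau>1 N + ?\<tau>2 N - phi \<alpha>1 \<beta> ((1 + y) * N) = \<kappa> * N ^ 3" for N
  proof -
    have "\<alpha>2 * y ^ 3 = \<alpha>1 * y" using y(2) by (metis mult.assoc power2_eq_square power3_eq_cube)
    thus ?thesis unfolding phi_scale by (simp add: \<kappa>_def algebra_simps)
  qed
  have in1: "\<exists>K. \<forall>N\<ge>1. modulation_size \<alpha>1 \<beta> (1 * N) (?\<tau>1 N) (?v N) (N powr - (1 / 2)) (N powr 0) \<le> K * N powr 0"
    by (rule modulation_size_parabolic[where A = 0 and B = 0]) auto
  have in2: "\<exists>K. \<forall>N\<ge>1. modulation_size \<alpha>2 \<beta> (y * N) (?\<tau>2 N) (?v N) (N powr - (1 / 2)) (N powr 0) \<le> K * N powr 0"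
    unfolding v by (rule modulation_size_parabolic[where A = 0 and B = 0]) auto
  have diff: "\<bar>?v N - (3 * \<alpha>1 * ((1 + y) * N)\<^sup>2 - \<beta>)\<bar> = \<bar>3 * \<alpha>1 * (1 - (1 + y)\<^sup>2)\<bar> * N\<^sup>2" for N
  proof -
    have "?v N - (3 * \<alpha>1 * ((1 + y) * N)\<^sup>2 - \<beta>) = 3 * \<alpha>1 * (1 - (1 + y)\<^sup>2) * N\<^sup>2"
      unfolding power_mult_distrib[of "1 + y" N] by (simp add: algebra_simps)
    thus ?thesis by (simp only: abs_mult abs_power2)
  qed
  have out: "\<exists>K. \<forall>N\<ge>1. modulation_size \<alpha>1 \<beta> ((1 + y) * N) (?\<tau>1 N + ?\<tau>2 N) (?v N) (N powr - (1 / 2)) (N powr 0) \<le> K * N powr 3"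
  proof (rule modulation_size_parabolic)
    fix N :: real
    assume N: "1 \<le> N"
    show "\<bar>?\<tau>1 N + ?\<tau>2 N - phi \<alpha>1 \<beta> ((1 + y) * N)\<bar> \<le> \<bar>\<kappa>\<bar> * N powr 3"
      unfolding \<tau> using N by (simp add: abs_mult)
    have "N\<^sup>2 \<le> N ^ 3" using N by (intro power_increasing) auto
    thus "\<bar>?v N - (3 * \<alpha>1 * ((1 + y) * N)\<^sup>2 - \<beta>)\<bar> \<le> \<bar>3 * \<alpha>1 * (1 - (1 + y)\<^sup>2)\<bar> * N powr 3"
      unfolding diff using N by (intro mult_left_mono) auto
  qed simp
  have low: "\<exists>K N0. \<forall>N\<ge>N0. \<forall>\<theta>\<in>{1..4}. \<forall>u\<in>{0..2}. N powr 3 \<le> K * jbr (?\<tau>1 N + ?\<tau>2 N + ?v N * (N powr - (1 / 2) * \<theta>)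
      + N powr 0 * u - phi \<alpha>1 \<beta> ((1 + y) * N + N powr - (1 / 2) * \<theta>))"
  proof (rule modulation_lower[OF _ \<kappa> _ \<tau>])
    show "\<exists>K. \<forall>N\<ge>1. modulation_size \<alpha>1 \<beta> ((1 + y) * N) (phi \<alpha>1 \<beta> ((1 + y) * N)) (?v N) (N powr - (1 / 2)) (N powr 0) \<le> K * N powr 2"
      by (rule modulation_size_parabolic[where A = 0 and B = "\<bar>3 * \<alpha>1 * (1 - (1 + y)\<^sup>2)\<bar>"]) (simp_all only: diff, auto)
  qed simp
  show ?thesis
    by (rule not_bilinear_estimate_asymptotic[OF T _ _ _ in1 in2 out low multiplier_lower[OF T _ m]])
       (use exponent y in \<open>auto simp: field_simps\<close>)
qed

text \<open>Opposite frequencies with different dispersions: the product has frequency near 0 and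
  modulation |\<alpha>1 - \<alpha>2| N^3 to leading order, while the multiplier is still of size N.
  The count is 2s < -1 + 1 + 3(b - 1).\<close>

lemma not_estimate_low_modulated_output:
  assumes T: "packet_multiplier T m c" and m: "\<And>N. m (1 * N) (- 1 * N) = \<mu> * N" "\<mu> \<noteq> 0"
    and "\<alpha>1 \<noteq> \<alpha>2" and exponent: "2 * s < 3 * b - 3"
  shows "\<not> bilinear_estimate T \<alpha>1 \<alpha>1 \<alpha>2 \<beta> s b"
proof -
  let ?\<tau>1 = "\<lambda>N. phi \<alpha>1 \<beta> (1 * N)" and ?\<tau>2 = "\<lambda>N. phi \<alpha>2 \<beta> (- 1 * N)"
  have inp: "\<exists>K. \<forall>N\<ge>1. modulation_size \<alpha> \<beta> (x * N) (phi \<alpha> \<beta> (x * N)) 0 (N powr - 2) (N powr 0) \<le> K * N powr h"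
    if "0 \<le> h" for \<alpha> x h
    using that by (intro modulation_size_point[where A = 0]) auto
  have \<tau>: "?\<tau>1 N + ?\<tau>2 N - phi \<alpha>1 \<beta> ((1 + - 1) * N) = (\<alpha>1 - \<alpha>2) * N ^ 3" for N
    by (simp add: phi_def algebra_simps)
  have out: "\<exists>K. \<forall>N\<ge>1. modulation_size \<alpha>1 \<beta> ((1 + - 1) * N) (?\<tau>1 N + ?\<tau>2 N) 0 (N powr - 2) (N powr 0) \<le> K * N powr 3"
    by (rule modulation_size_point[where A = "\<bar>\<alpha>1 - \<alpha>2\<bar>"]) (simp_all only: \<tau>, auto simp: abs_mult)
  have low: "\<exists>K N0. \<forall>N\<ge>N0. \<forall>\<theta>\<in>{1..4}. \<forall>u\<in>{0..2}. N powr 3 \<le> K * jbr (?\<tau>1 N + ?\<tau>2 N + 0 * (N powr - 2 * \<theta>)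
      + N powr 0 * u - phi \<alpha>1 \<beta> ((1 + - 1) * N + N powr - 2 * \<theta>))"
    by (rule modulation_lower[OF _ _ inp \<tau>]) (use assms in auto)
  show ?thesis
    by (rule not_bilinear_estimate_asymptotic[OF T _ _ _ inp[of 0] inp[of 0] out low multiplier_lower[OF T _ m]])
       (use exponent in \<open>auto simp: field_simps\<close>)
qed

section \<open>Zeros of the resonance functions\<close>

text \<open>For frequencies x and 1 - x the cubic terms cancel and the equation is 3x^2 - 3x + 1 =
  r, with real roots as r > 1/4. The values 0 and 1 would give r = 1.\<close>

lemma resonant_frequencies_divergence:
  fixes r :: real
  assumes "1 / 4 < r" "r \<noteq> 1"
  obtains x where "x \<noteq> 0" "x \<noteq> 1" "x ^ 3 + (1 - x) ^ 3 = r"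
proof -
  define q where "q = sqrt ((4 * r - 1) / 3)"
  define x where "x = (1 + q) / 2"
  have "q\<^sup>2 = (4 * r - 1) / 3" using assms by (simp add: q_def)
  moreover have "3 * x\<^sup>2 - 3 * x + 1 = (3 * q\<^sup>2 + 1) / 4"
    by (simp add: x_def power2_eq_square field_simps)
  ultimately have "3 * x\<^sup>2 - 3 * x + 1 = r" by simp
  hence "x ^ 3 + (1 - x) ^ 3 = r" by (simp add: power2_eq_square power3_eq_cube algebra_simps)
  moreover from this have "x \<noteq> 0" "x \<noteq> 1" using assms(2) by auto
  ultimately show thesis using that by blast
qed

text \<open>The trivial zero x = 1 splits off; the remaining quadratic has discriminant 3(4r - 1),
  takes the value 1 - r at 0 and 3 at 1.\<close>

lemma resonant_frequencies_mixed:
  fixes r :: real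
  assumes "1 / 4 < r" "r \<noteq> 1"
  obtains x where "x \<noteq> 0" "x \<noteq> 1" "x ^ 3 + r * (1 - x) ^ 3 = 1"
proof -
  define q where "q = sqrt (3 * (4 * r - 1))"
  \<comment> \<open>The quadratic formula for (1 - r) x^2 + (1 + 2r) x + (1 - r) = 0.\<close>
  define x where "x = (q - (1 + 2 * r)) / (2 * (1 - r))"
  have q: "q\<^sup>2 = 3 * (4 * r - 1)" using assms by (simp add: q_def)
  have "2 * (1 - r) * x = q - (1 + 2 * r)" using assms by (simp add: x_def)
  hence "q = 2 * (1 - r) * x + (1 + 2 * r)" by simp
  hence "(2 * (1 - r) * x + (1 + 2 * r))\<^sup>2 = 3 * (4 * r - 1)" using q by simp
  hence "4 * (1 - r) * ((1 - r) * x\<^sup>2 + (1 + 2 * r) * x + (1 - r)) = 0"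
    by (simp add: power2_eq_square algebra_simps)
  hence x: "(1 - r) * x\<^sup>2 + (1 + 2 * r) * x + (1 - r) = 0" using assms by simp
  have "x ^ 3 + r * (1 - x) ^ 3 - 1 = (x - 1) * ((1 - r) * x\<^sup>2 + (1 + 2 * r) * x + (1 - r))"
    by (simp add: power2_eq_square power3_eq_cube algebra_simps)
  hence "x ^ 3 + r * (1 - x) ^ 3 = 1" using x by simp
  moreover have "x \<noteq> 0" "x \<noteq> 1" using x assms by auto
  ultimately show thesis using that by blast
qed

section \<open>Examples matched with the ranges of r and s\<close>

lemma not_divergence_estimate_below:
  assumes "\<alpha>1 \<noteq> 0" "s < - 3 / 4"
  shows "\<not> bilinear_estimate (\<lambda>w1 w2. pdx (\<lambda>z. w1 z * w2 z)) \<alpha>0 \<alpha>1 \<alpha>1 \<beta> s b"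
proof (cases "b \<le> 0")
  case True
  show ?thesis
    by (rule not_estimate_nonpos_b[OF packet_multiplier_divergence, where \<mu> = 2]) (use True assms in auto)
next
  case False
  thus ?thesis using assms by (intro not_estimate_low_output) auto
qed

text \<open>At r = 1/4 the quadratic for the mixed resonance has the double root x = -1, that is,
  the frequencies -1 and 2.\<close>

lemma not_mixed_estimate_quarter:
  assumes T: "packet_multiplier T m c" and m: "\<And>N. m (- 1 * N) (2 * N) = \<mu> * N" "\<mu> \<noteq> 0"
    and "\<alpha>1 = 4 * \<alpha>2" "s < 3 / 4"
  shows "\<not> bilinear_estimate T \<alpha>1 \<alpha>1 \<alpha>2 \<beta> s b"
  by (rule not_estimate_parabolic_resonance[OF T m]) (use assms in auto)

text \<open>The three choices of A, B are the derivative of the product, of the first and of the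
  second factor. At (x, 1 - x) the multiplier is 1, x or 1 - x, so a nontrivial zero of the
  resonance function makes each of them nonzero.\<close>

lemma not_mixed_estimate_resonance:
  assumes T: "packet_multiplier T (\<lambda>\<xi> \<xi>'. A * \<xi> + B * \<xi>') c"
    and AB: "A = 1 \<and> B = 1 \<or> A = 1 \<and> B = 0 \<or> A = 0 \<and> B = 1"
    and "\<alpha>1 \<noteq> 0" "1 / 4 < \<alpha>2 / \<alpha>1" "\<alpha>2 / \<alpha>1 \<noteq> 1" "s < 0"
  shows "\<not> bilinear_estimate T \<alpha>1 \<alpha>1 \<alpha>2 \<beta> s b"
proof -
  obtain x where x: "x \<noteq> 0" "x \<noteq> 1" "x ^ 3 + \<alpha>2 / \<alpha>1 * (1 - x) ^ 3 = 1"
    using resonant_frequencies_mixed assms by blast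
  have "\<alpha>1 * (x ^ 3 + \<alpha>2 / \<alpha>1 * (1 - x) ^ 3) = \<alpha>1 * x ^ 3 + \<alpha>2 * (1 - x) ^ 3"
    using \<open>\<alpha>1 \<noteq> 0\<close> by (simp add: field_simps)
  hence resonance: "\<alpha>1 * (x + (1 - x)) ^ 3 = \<alpha>1 * x ^ 3 + \<alpha>2 * (1 - x) ^ 3"
    using x by simp
  show ?thesis
    by (rule not_estimate_resonance[OF T _ _ _ _ resonance, where \<mu> = "A * x + B * (1 - x)"])
       (use x AB assms in \<open>auto simp: algebra_simps\<close>)
qed

text \<open>If the modulated input gives no contradiction, then b > 0 and 3b >= 3/4 - s, whence 3b -
  9/4 >= -s - 3/2 > s, the condition for the modulated output. Here r > 0 supplies the real
  frequency y with equal slopes.\<close>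

lemma not_mixed_divergence_estimate_below:
  assumes "\<alpha>1 \<noteq> 0" "0 < \<alpha>2 / \<alpha>1" "s < - 3 / 4"
  shows "\<not> bilinear_estimate (\<lambda>w1 w2. pdx (\<lambda>z. w1 z * w2 z)) \<alpha>1 \<alpha>1 \<alpha>2 \<beta> s b"
proof (cases "s + 3 * max b 0 < 3 / 4")
  case True
  show ?thesis
    by (rule not_estimate_modulated_input[OF packet_multiplier_divergence, where \<mu> = 1]) (use True in auto)
next
  case False
  define y where "y = 1 / sqrt (\<alpha>2 / \<alpha>1)"
  have y: "0 < y" using assms by (simp add: y_def)
  have "y\<^sup>2 = \<alpha>1 / \<alpha>2" using assms by (simp add: y_def power_divide)
  hence y2: "\<alpha>2 * y\<^sup>2 = \<alpha>1" using assms by auto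
  show ?thesis
    by (rule not_estimate_parabolic_modulated_output[OF packet_multiplier_divergence, where \<mu> = "1 + y" and y = y])
       (use False assms y y2 in \<open>auto simp: algebra_simps\<close>)
qed

text \<open>If the modulated input gives no contradiction, then 3b >= 3/4 - s, so 3b - 3 >= -s - 9/4
  > 2s, and the product near frequency zero applies.\<close>

lemma not_mixed_nondivergence_estimate_below:
  assumes T: "packet_multiplier T m c"
    and m: "\<And>N. m (- 1 * N) (2 * N) = \<mu> * N" "\<mu> \<noteq> 0" "\<And>N. m (1 * N) (- 1 * N) = \<mu>' * N" "\<mu>' \<noteq> 0"
    and "\<alpha>1 \<noteq> \<alpha>2" "s < - 3 / 4"
  shows "\<not> bilinear_estimate T \<alpha>1 \<alpha>1 \<alpha>2 \<beta> s b"
proof (cases "s + 3 * max b 0 < 3 / 4")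
  case True
  thus ?thesis by (intro not_estimate_modulated_input[OF T m(1,2)])
next
  case False
  show ?thesis
    by (rule not_estimate_low_modulated_output[OF T m(3,4)]) (use False assms in auto)
qed

text \<open>Opposite frequencies are trivially resonant for equal dispersions, and a derivative on a
  single factor does not see that the total frequency is zero.\<close>

lemma not_nondivergence_estimate_equal:
  assumes T: "packet_multiplier T m c" and m: "\<And>N. m (1 * N) (- 1 * N) = \<mu> * N" "\<mu> \<noteq> 0"
    and "s < 0"
  shows "\<not> bilinear_estimate T \<alpha> \<alpha> \<alpha> \<beta> s b"
  by (rule not_estimate_resonance[OF T m]) (use assms in auto)

theorem theorem1p15:
  fixes \<alpha>1 \<alpha>2 \<beta> s b :: real
  assumes "\<alpha>1 \<noteq> 0" and "\<alpha>2 \<noteq> 0"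
  defines "r \<equiv> \<alpha>2 / \<alpha>1"
  shows
   "(((r < 0 \<and> s < -3/4) \<or> (0 < r \<and> r < 1/4 \<and> s < -3/4) \<or> (r = 1/4 \<and> s < 3/4)
       \<or> (r > 1/4 \<and> r \<noteq> 1 \<and> s < 0) \<or> (r = 1 \<and> s < -3/4)) \<longrightarrow>
     \<not> (\<exists>C::real. \<forall>w1 w2. schwartz w1 \<longrightarrow> schwartz w2 \<longrightarrow>
          Xnorm \<alpha>2 \<beta> s (b - 1) (pdx (\<lambda>z. w1 z * w2 z))
            \<le> C * Xnorm \<alpha>1 \<beta> s b w1 * Xnorm \<alpha>1 \<beta> s b w2))
  \<and> (((0 < r \<and> r < 1/4 \<and> s < -3/4) \<or> (r = 1/4 \<and> s < 3/4)
       \<or> (r > 1/4 \<and> r \<noteq> 1 \<and> s < 0) \<or> (r = 1 \<and> s < -3/4)) \<longrightarrow>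
     \<not> (\<exists>C::real. \<forall>w1 w2. schwartz w1 \<longrightarrow> schwartz w2 \<longrightarrow>
          Xnorm \<alpha>1 \<beta> s (b - 1) (pdx (\<lambda>z. w1 z * w2 z))
            \<le> C * Xnorm \<alpha>1 \<beta> s b w1 * Xnorm \<alpha>2 \<beta> s b w2))
  \<and> (((r < 0 \<and> s < -3/4) \<or> (0 < r \<and> r < 1/4 \<and> s < -3/4) \<or> (r = 1/4 \<and> s < 3/4)
       \<or> (r > 1/4 \<and> r \<noteq> 1 \<and> s < 0) \<or> (r = 1 \<and> s < 0)) \<longrightarrow>
     \<not> (\<exists>C::real. \<forall>w1 w2. schwartz w1 \<longrightarrow> schwartz w2 \<longrightarrow>
          Xnorm \<alpha>1 \<beta> s (b - 1) (\<lambda>z. pdx w1 z * w2 z)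
            \<le> C * Xnorm \<alpha>1 \<beta> s b w1 * Xnorm \<alpha>2 \<beta> s b w2))
  \<and> (((r < 0 \<and> s < -3/4) \<or> (0 < r \<and> r < 1/4 \<and> s < -3/4) \<or> (r = 1/4 \<and> s < 3/4)
       \<or> (r > 1/4 \<and> r \<noteq> 1 \<and> s < 0) \<or> (r = 1 \<and> s < 0)) \<longrightarrow>
     \<not> (\<exists>C::real. \<forall>w1 w2. schwartz w1 \<longrightarrow> schwartz w2 \<longrightarrow>
          Xnorm \<alpha>1 \<beta> s (b - 1) (\<lambda>z. w1 z * pdx w2 z)
            \<le> C * Xnorm \<alpha>1 \<beta> s b w1 * Xnorm \<alpha>2 \<beta> s b w2))"
proof -
  let ?D = "\<lambda>w1 w2 :: real \<times> real \<Rightarrow> complex. pdx (\<lambda>z. w1 z * w2 z)"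
    and ?L = "\<lambda>(w1 :: real \<times> real \<Rightarrow> complex) w2 z. pdx w1 z * w2 z"
    and ?R = "\<lambda>(w1 :: real \<times> real \<Rightarrow> complex) w2 z. w1 z * pdx w2 z"
  have quarter: "\<alpha>1 = 4 * \<alpha>2" if "r = 1 / 4" using that assms by (simp add: field_simps)
  have one: "\<alpha>2 = \<alpha>1" if "r = 1" using that assms by (simp add: field_simps)
  have other: "\<alpha>1 \<noteq> \<alpha>2" if "r \<noteq> 1" using that assms by auto
  \<comment> \<open>The cases are regrouped by the example that settles them; here the range s <
    -3/4 is treated for all r together.\<close>
  have D1: "\<not> bilinear_estimate ?D \<alpha>2 \<alpha>1 \<alpha>1 \<beta> s b"
    if "s < - 3 / 4 \<or> (r = 1 / 4 \<and> s < 3 / 4) \<or> (r > 1 / 4 \<and> r \<noteq> 1 \<and> s < 0)"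
    using that
  proof (elim disjE conjE)
    assume "s < - 3 / 4"
    thus ?thesis using assms by (intro not_divergence_estimate_below) auto
  next
    assume "r = 1 / 4" "s < 3 / 4"
    with quarter show ?thesis
      by (intro not_estimate_parabolic_resonance[OF packet_multiplier_divergence, where ?x1.0 = 1 and ?x2.0 = 1 and \<mu> = 2]) auto
  next
    assume r: "r > 1 / 4" "r \<noteq> 1" and "s < 0"
    then obtain x where x: "x \<noteq> 0" "x \<noteq> 1" "x ^ 3 + (1 - x) ^ 3 = r"
      using resonant_frequencies_divergence by blast
    have "\<alpha>1 * (x ^ 3 + (1 - x) ^ 3) = \<alpha>2" unfolding x(3) using assms by simp
    hence resonance: "\<alpha>2 * (x + (1 - x)) ^ 3 = \<alpha>1 * x ^ 3 + \<alpha>1 * (1 - x) ^ 3"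
      by (simp add: distrib_left)
    show ?thesis
      by (rule not_estimate_resonance[OF packet_multiplier_divergence _ _ _ _ resonance, where \<mu> = 1])
         (use x \<open>s < 0\<close> in \<open>auto simp: algebra_simps\<close>)
  qed
  have D2: "\<not> bilinear_estimate ?D \<alpha>1 \<alpha>1 \<alpha>2 \<beta> s b"
    if "(0 < r \<and> s < - 3 / 4) \<or> (r = 1 / 4 \<and> s < 3 / 4) \<or> (r > 1 / 4 \<and> r \<noteq> 1 \<and> s < 0)"
    using that
  proof (elim disjE conjE)
    assume "0 < r" "s < - 3 / 4"
    thus ?thesis using assms by (intro not_mixed_divergence_estimate_below) (auto simp: r_def)
  next
    assume "r = 1 / 4" "s < 3 / 4"
    with quarter show ?thesis
      by (intro not_mixed_estimate_quarter[OF packet_multiplier_divergence, where \<mu> = 1]) auto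
  next
    assume "r > 1 / 4" "r \<noteq> 1" "s < 0"
    thus ?thesis using assms packet_multiplier_divergence
      by (intro not_mixed_estimate_resonance[where A = 1 and B = 1 and c = 1]) (auto simp: r_def)
  qed
  have ND1: "\<not> bilinear_estimate ?L \<alpha>1 \<alpha>1 \<alpha>2 \<beta> s b"
    if "(r \<noteq> 1 \<and> s < - 3 / 4) \<or> (r = 1 / 4 \<and> s < 3 / 4) \<or> (r > 1 / 4 \<and> r \<noteq> 1 \<and> s < 0) \<or> (r = 1 \<and> s < 0)"
    using that
  proof (elim disjE conjE)
    \<comment> \<open>The witnesses are the frequencies of the differentiated first factor: -1 in
      the modulated-input example and 1 in the one with opposite frequencies.\<close>
    assume "r \<noteq> 1" "s < - 3 / 4"
    thus ?thesis using other
      by (intro not_mixed_nondivergence_estimate_below[OF packet_multiplier_left, where \<mu> = "- 1" and \<mu>' = 1]) auto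
  next
    assume "r = 1 / 4" "s < 3 / 4"
    with quarter show ?thesis
      by (intro not_mixed_estimate_quarter[OF packet_multiplier_left, where \<mu> = "- 1"]) auto
  next
    assume "r > 1 / 4" "r \<noteq> 1" "s < 0"
    thus ?thesis using assms packet_multiplier_left
      by (intro not_mixed_estimate_resonance[where A = 1 and B = 0 and c = "1 / 2"]) (auto simp: r_def)
  next
    assume "r = 1" "s < 0"
    thus ?thesis unfolding one[OF \<open>r = 1\<close>]
      by (intro not_nondivergence_estimate_equal[OF packet_multiplier_left, where \<mu> = 1]) auto
  qed
  have ND2: "\<not> bilinear_estimate ?R \<alpha>1 \<alpha>1 \<alpha>2 \<beta> s b"
    if "(r \<noteq> 1 \<and> s < - 3 / 4) \<or> (r = 1 / 4 \<and> s < 3 / 4) \<or> (r > 1 / 4 \<and> r \<noteq> 1 \<and> s < 0) \<or> (r = 1 \<and> s < 0)"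
    using that
  proof (elim disjE conjE)
    assume "r \<noteq> 1" "s < - 3 / 4"
    thus ?thesis using other
      by (intro not_mixed_nondivergence_estimate_below[OF packet_multiplier_right, where \<mu> = 2 and \<mu>' = "- 1"]) auto
  next
    assume "r = 1 / 4" "s < 3 / 4"
    with quarter show ?thesis
      by (intro not_mixed_estimate_quarter[OF packet_multiplier_right, where \<mu> = 2]) auto
  next
    assume "r > 1 / 4" "r \<noteq> 1" "s < 0"
    thus ?thesis using assms packet_multiplier_right
      by (intro not_mixed_estimate_resonance[where A = 0 and B = 1 and c = "1 / 2"]) (auto simp: r_def)
  next
    assume "r = 1" "s < 0"
    thus ?thesis unfolding one[OF \<open>r = 1\<close>]
      by (intro not_nondivergence_estimate_equal[OF packet_multiplier_right, where \<mu> = "- 1"]) auto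
  qed
  show ?thesis
    using D1 D2 ND1 ND2 unfolding bilinear_estimate_def by (intro conjI impI) argo+
qed

end
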